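(* Suppose Assumptions 1–3 hold, $\Pi_{2u}\Pi_{2u}^\top\succ0$, and $\mu\ge\max\{\hat L_f,L_h\}$. Then there exist $\epsilon>0$, $\rho>0$, $\varphi_1,\varphi_2\ge0$ and a matrix $\mathbf P\succ0$ such that $\mathbf A_{\epsilon\rho}$ satisfies $\mathrm{LMI}(\mathbf P,\Xi_\varphi)$.
   Context: Let $A\in\mathbb R^{n\times n}$ be Hurwitz, $B\in\mathbb R^{n\times p}$, $B_w\in\mathbb R^{n\times q}$, and for $i=1,2$ let $C_i\in\mathbb R^{r_i\times n}$, $D_{iw}\in\mathbb R^{r_i\times q}$. Define $\Pi_{iu}:=-C_iA^{-1}B$ and $\Pi_{iw}:=-C_iA^{-1}B_w+D_{iw}$. For $t\ge0$ let $f^t:\mathbb R^p\to\mathbb R$, $h^t:\mathbb R^{r_1}\to\mathbb R$ and $g^t:\mathbb R^{r_2}\to\mathbb R\cup\{+\infty\}$ be given, let $w:[0,\infty)\to\mathbb R^q$, and fix $\mu>0$. Definitions. - $M_{\mu g}(v):=\min_x g(x)+\frac1{2\mu}\|x-v\|^2$ is the Moreau envelope, with $\nabla M_{\mu g}(v)=\frac1\mu(v-\mathbf{prox}_{\mu g}(v))$, where $\mathbf{prox}_{\mu g}(v)$ is the minimizer. - $\mathcal P(t)$: minimize $f^t(u)+h^t(y_1)+g^t(y_2)$ subject to $y_i=\Pi_{iu}u+\Pi_{iw}w(t)$. - Its optimal primal-dual pairs are saddle points of $f^t(u)+h^t(\Pi_{1u}u+\Pi_{1w}w(t))+M_{\mu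 g^t}(\Pi_{2u}u+\Pi_{2w}w(t)+\mu\lambda)-\frac\mu2\|\lambda\|^2$. Assumptions. - Assumption 1: for all $t$, $f^t$ is $m$-strongly convex with $L_f$-Lipschitz gradient, $h^t$ is convex with $L_h$-Lipschitz gradient, and $g^t$ is proper, convex and lsc. - Assumption 2: $\mathcal P(t)$ is feasible for all $t\ge0$ and $t\mapsto(u^\star(t),\lambda^\star(t))$ is measurable. - Assumption 3: the right-hand side of the closed-loop system $\dot x=Ax+Bu+B_ww$, $\dot u=-\nabla f^t(u)-\Pi_{1u}^\top\nabla h^t(y_1)-\Pi_{2u}^\top\nabla M_{\mu g^t}(y_2+\mu\lambda)$, $\dot\lambda=\mu(\nabla M_{\mu g^t}(y_2+\mu\lambda)-\lambda)$, $y_i=C_ix+D_{iw}w(t)$, is measurable in $t$ and continuous for almost all $t$. Matrices. Let $\hat L_f:=L_f-m$. For $\epsilon>0$ and $\rho\ge0$ define $$\mathbf A_\epsilon:=\begin{bmatrix}\frac1\epsilon A&\frac1\epsilon B&0\\0&-mI&0\\0&0&-\mu I\end{bmatrix},\qquad \mathbf A_{\epsilon\rho}:=\mathbf A_\epsilon+\rho I,$$ $$\mathbf B=\begin{bmatrix}0&0&0\\-I&-\Pi_{1u}^\top&-\frac1\mu\Pi_{2u}^\top\\0&0&I\end{bmatrix},\qquad \mathbf C=\begin{bmatrix}0&I&0\\C_1&0&0\\C_2&0&\mu I\end{bmatrix}.$$ ($\mathbf A_\epsilon$ corresponds to the closed loop with the physical system sped up to $\epsilon\dot x=Ax+Bu+B_ww$.)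 LMI condition. For $\varphi_1,\varphi_2\ge0$, $\Xi_\varphi$ is the $6\times6$ block matrix, with block sizes $(p,r_1,r_2,p,r_1,r_2)$, whose nonzero blocks are: - $(1,4)=(4,1)=\varphi_1\hat L_fI$ and $(4,4)=-2\varphi_1I$; - $(2,5)=(5,2)=\varphi_2L_hI$ and $(5,5)=-2\varphi_2I$; - $(3,6)=(6,3)=I$ and $(6,6)=-2I$. A matrix $\mathbf A'$ satisfies $\mathrm{LMI}(\mathbf P,\Xi_\varphi)$ if $\begin{bmatrix}\mathbf A'^\top\mathbf P+\mathbf P\mathbf A'&\mathbf P\mathbf B\\\mathbf B^\top\mathbf P&0\end{bmatrix}+\begin{bmatrix}\mathbf C^\top&0\\0&I\end{bmatrix}\Xi_\varphi\begin{bmatrix}\mathbf C&0\\0&I\end{bmatrix}\preceq0$. *)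

theory Defs
  imports "HOL-Analysis.Analysis"
begin

definition hcat :: "real^'b^'a \<Rightarrow> real^'c^'a \<Rightarrow> real^('b + 'c)^'a" where
  "hcat M N = (\<chi> i j. case j of Inl b \<Rightarrow> M $ i $ b | Inr c \<Rightarrow> N $ i $ c)"

definition vcat :: "real^'c^'a \<Rightarrow> real^'c^'b \<Rightarrow> real^'c^('a + 'b)" where
  "vcat M N = (\<chi> i. case i of Inl a \<Rightarrow> M $ a | Inr b \<Rightarrow> N $ b)"

definition blk2 :: "real^'b^'a \<Rightarrow> real^'d^'a \<Rightarrow> real^'b^'c \<Rightarrow> real^'d^'c
    \<Rightarrow> real^('b + 'd)^('a + 'c)" where
  "blk2 M11 M12 M21 M22 = vcat (hcat M11 M12) (hcat M21 M22)"

definition dg3 :: "real \<Rightarrow> real \<Rightarrow> real \<Rightarrow> real^(('p::finite + 'r1::finite) + 'r2::finite)^(('p + 'r1) + 'r2)" where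
  "dg3 a b c = (\<chi> i j. if i = j then
      (case i of Inl (Inl _) \<Rightarrow> a | Inl (Inr _) \<Rightarrow> b | Inr _ \<Rightarrow> c) else 0)"

definition pos_def :: "real^'n^'n \<Rightarrow> bool" where
  "pos_def M \<longleftrightarrow> transpose M = M \<and> (\<forall>x. x \<noteq> 0 \<longrightarrow> 0 < x \<bullet> (M *v x))"

definition neg_semidef :: "real^'n^'n \<Rightarrow> bool" where
  "neg_semidef M \<longleftrightarrow> transpose M = M \<and> (\<forall>x. x \<bullet> (M *v x) \<le> 0)"

definition hurwitz :: "real^'n^'n \<Rightarrow> bool" where
  "hurwitz A \<longleftrightarrow> (\<forall>(lam::complex) (v::complex^'n). v \<noteq> 0 \<and>
       (\<chi> i j. complex_of_real (A $ i $ j)) *v v = lam *s v \<longrightarrow> Re lam < 0)"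

text \<open>State index: ('n + 'p) + 'r2 for (x,u,lambda); input/output index: ('p + 'r1) + 'r2.\<close>

definition Pi_u :: "real^'n::finite^'n \<Rightarrow> real^'p^'n \<Rightarrow> real^'n^'r \<Rightarrow> real^'p^'r" where
  "Pi_u A B C = - (C ** matrix_inv A ** B)"

definition Pi_w :: "real^'n::finite^'n \<Rightarrow> real^'q^'n \<Rightarrow> real^'n^'r \<Rightarrow> real^'q^'r \<Rightarrow> real^'q^'r" where
  "Pi_w A Bw C Dw = - (C ** matrix_inv A ** Bw) + Dw"

definition A_eps :: "real^'n::finite^'n \<Rightarrow> real^'p::finite^'n \<Rightarrow> real \<Rightarrow> real \<Rightarrow> real
    \<Rightarrow> real^(('n + 'p) + 'r2::finite)^(('n + 'p) + 'r2)" where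
  "A_eps A B m mu eps =
     blk2 (blk2 ((1/eps) *\<^sub>R A) ((1/eps) *\<^sub>R B) 0 (- (m *\<^sub>R mat 1))) 0 0 (- (mu *\<^sub>R mat 1))"

definition A_eps_rho :: "real^'n::finite^'n \<Rightarrow> real^'p::finite^'n \<Rightarrow> real \<Rightarrow> real \<Rightarrow> real \<Rightarrow> real
    \<Rightarrow> real^(('n + 'p) + 'r2::finite)^(('n + 'p) + 'r2)" where
  "A_eps_rho A B m mu eps rho = A_eps A B m mu eps + rho *\<^sub>R mat 1"

definition B_bold :: "real^'n::finite^'n \<Rightarrow> real^'p::finite^'n \<Rightarrow> real^'n^'r1::finite \<Rightarrow> real^'n^'r2::finite \<Rightarrow> real
    \<Rightarrow> real^(('p + 'r1) + 'r2)^(('n + 'p) + 'r2)" where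
  "B_bold A B C1 C2 mu =
     blk2 (blk2 0 0 (- mat 1) (- transpose (Pi_u A B C1)))
          (vcat 0 (- ((1/mu) *\<^sub>R transpose (Pi_u A B C2))))
          0 (mat 1)"

definition C_bold :: "real^'n::finite^'r1::finite \<Rightarrow> real^'n^'r2::finite \<Rightarrow> real
    \<Rightarrow> real^(('n + 'p::finite) + 'r2)^(('p + 'r1) + 'r2)" where
  "C_bold C1 C2 mu =
     vcat (vcat (hcat (hcat 0 (mat 1)) 0) (hcat (hcat C1 0) 0))
          (hcat (hcat C2 0) (mu *\<^sub>R mat 1))"

definition Xi :: "real \<Rightarrow> real \<Rightarrow> real \<Rightarrow> real
    \<Rightarrow> real^((('p::finite + 'r1::finite) + 'r2::finite) + (('p + 'r1) + 'r2))^((('p + 'r1) + 'r2) + (('p + 'r1) + 'r2))" where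
  "Xi hLf Lh phi1 phi2 = blk2 0 (dg3 (phi1 * hLf) (phi2 * Lh) 1) (dg3 (phi1 * hLf) (phi2 * Lh) 1)
                          (dg3 (-2 * phi1) (-2 * phi2) (-2))"

definition LMI :: "real^'x::finite^'x \<Rightarrow> real^'x^'x \<Rightarrow> real^'v^'x \<Rightarrow> real^'x^'v
    \<Rightarrow> real^('v::finite + 'v)^('v + 'v) \<Rightarrow> bool" where
  "LMI A' P BB CC X \<longleftrightarrow>
     neg_semidef (blk2 (transpose A' ** P + P ** A') (P ** BB) (transpose BB ** P) 0
        + transpose (blk2 CC 0 0 (mat 1)) ** X ** blk2 CC 0 0 (mat 1))"

definition strongly_convex :: "real \<Rightarrow> ('a::real_inner \<Rightarrow> real) \<Rightarrow> bool" where
  "strongly_convex m f \<longleftrightarrow> 0 < m \<and> convex_on UNIV (\<lambda>x. f x - (m / 2) * (norm x)^2)"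

definition lipschitz_gradient :: "real \<Rightarrow> ('a::real_inner \<Rightarrow> real) \<Rightarrow> ('a \<Rightarrow> 'a) \<Rightarrow> bool" where
  "lipschitz_gradient L f grad \<longleftrightarrow>
     (\<forall>x. (f has_derivative (\<lambda>d. grad x \<bullet> d)) (at x)) \<and>
     (\<forall>x y. norm (grad x - grad y) \<le> L * norm (x - y))"

definition proper_ext :: "('a \<Rightarrow> ereal) \<Rightarrow> bool" where
  "proper_ext g \<longleftrightarrow> (\<forall>x. g x \<noteq> -\<infinity>) \<and> (\<exists>x. g x \<noteq> \<infinity>)"

definition convex_ext :: "('a::real_vector \<Rightarrow> ereal) \<Rightarrow> bool" where
  "convex_ext g \<longleftrightarrow> convex {(x, y::real). g x \<le> ereal y}"

definition lsc_ext :: "('a::topological_space \<Rightarrow> ereal) \<Rightarrow> bool" where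
  "lsc_ext g \<longleftrightarrow> (\<forall>x. g x \<le> Liminf (at x) g)"

definition moreau :: "real \<Rightarrow> ('a::real_normed_vector \<Rightarrow> ereal) \<Rightarrow> 'a \<Rightarrow> real" where
  "moreau mu g v = real_of_ereal (INF x. g x + ereal ((norm (x - v))^2 / (2 * mu)))"

definition prox :: "real \<Rightarrow> ('a::real_normed_vector \<Rightarrow> ereal) \<Rightarrow> 'a \<Rightarrow> 'a" where
  "prox mu g v = (SOME x. \<forall>y. g x + ereal ((norm (x - v))^2 / (2 * mu))
                              \<le> g y + ereal ((norm (y - v))^2 / (2 * mu)))"

definition grad_moreau :: "real \<Rightarrow> ('a::real_normed_vector \<Rightarrow> ereal) \<Rightarrow> 'a \<Rightarrow> 'a" where
  "grad_moreau mu g v = (1 / mu) *\<^sub>R (v - prox mu g v)"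

text \<open>Regularized Lagrangian of P(t) whose saddle points are the optimal primal-dual pairs.\<close>
definition lagr :: "real^'n::finite^'n \<Rightarrow> real^'p::finite^'n \<Rightarrow> real^'q::finite^'n \<Rightarrow> real^'n^'r1::finite \<Rightarrow> real^'q^'r1
    \<Rightarrow> real^'n^'r2::finite \<Rightarrow> real^'q^'r2 \<Rightarrow> real
    \<Rightarrow> (real^'p \<Rightarrow> real) \<Rightarrow> (real^'r1 \<Rightarrow> real) \<Rightarrow> (real^'r2 \<Rightarrow> ereal) \<Rightarrow> real^'q
    \<Rightarrow> real^'p \<Rightarrow> real^'r2 \<Rightarrow> real" where
  "lagr A B Bw C1 D1w C2 D2w mu f h g wt u lam =
     f u + h (Pi_u A B C1 *v u + Pi_w A Bw C1 D1w *v wt)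
     + moreau mu g (Pi_u A B C2 *v u + Pi_w A Bw C2 D2w *v wt + mu *\<^sub>R lam)
     - (mu / 2) * (norm lam)^2"

definition saddle_point :: "('u \<Rightarrow> 'l \<Rightarrow> real) \<Rightarrow> 'u \<Rightarrow> 'l \<Rightarrow> bool" where
  "saddle_point L us ls \<longleftrightarrow> (\<forall>u l. L us l \<le> L us ls \<and> L us ls \<le> L u ls)"

definition closed_loop_rhs :: "real^'n::finite^'n \<Rightarrow> real^'p::finite^'n \<Rightarrow> real^'q::finite^'n \<Rightarrow> real^'n^'r1::finite \<Rightarrow> real^'q^'r1
    \<Rightarrow> real^'n^'r2::finite \<Rightarrow> real^'q^'r2 \<Rightarrow> real
    \<Rightarrow> (real \<Rightarrow> real^'p \<Rightarrow> real^'p) \<Rightarrow> (real \<Rightarrow> real^'r1 \<Rightarrow> real^'r1) \<Rightarrow> (real \<Rightarrow> real^'r2 \<Rightarrow> ereal)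
    \<Rightarrow> (real \<Rightarrow> real^'q) \<Rightarrow> real \<Rightarrow> (real^'n) \<times> (real^'p) \<times> (real^'r2) \<Rightarrow> (real^'n) \<times> (real^'p) \<times> (real^'r2)" where
  "closed_loop_rhs A B Bw C1 D1w C2 D2w mu gf gh g w t z =
     (case z of (x, u, lam) \<Rightarrow>
       (let y1 = C1 *v x + D1w *v w t; y2 = C2 *v x + D2w *v w t;
            gm = grad_moreau mu (g t) (y2 + mu *\<^sub>R lam) in
        (A *v x + B *v u + Bw *v w t,
         - gf t u - transpose (Pi_u A B C1) *v gh t y1 - transpose (Pi_u A B C2) *v gm,
         mu *\<^sub>R (gm - lam))))"

end

(* In the boundary-layer variable y = x + inverse(A) B u the state matrix decouples: the plant contributes
   y' = (1/eps) A y + (input rate), and the remaining (u, lambda) subsystem sees the outputs through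
   Pi_1u and Pi_2u. For that subsystem the storage mu |u|^2 + 2 beta <lambda, Pi_2u u> + mu |lambda|^2 with
   beta = 0 gives a form that is negative definite in u, a, b and d = c - mu lambda, where (a, b, c) is the
   input, but does not see lambda. A small beta > 0 adds
   - beta |transpose(Pi_2u) lambda|^2, which is definite because Pi_2u has full row rank, so the form
   becomes strictly negative in all variables. Adding <y, X y> with X the Lyapunov matrix of A, all terms
   coupling y to the rest are dominated by -|y|^2 / (2 eps) for small eps, and strictness leaves room for
   rho > 0. *)

theory Submission
  imports Defs "HOL-Computational_Algebra.Fundamental_Theorem_Algebra"
begin

section \<open>Block vectors and matrices\<close>

text \<open>The weights mu in the storage come from two exact cancellations. Write T for
  \<open>Pi_u A B C2\<close> and d = c - mu lambda. Because of the factor 1/mu in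
  \<open>B_bold\<close>, the weight mu on |u|^2 produces -<T u, c>, which cancels the same term of
  the multiplier; the weight mu on |lambda|^2 turns all terms in lambda and c into -|d|^2. The
  couplings of u with a and b have coefficients phi L - mu: they vanish for phi = mu / L, and for L
  = 0 a large phi outweighs them. The constants are fixed in the order phi, beta, delta (the slow
  margin), rho, eps. As rho precedes eps, the share rho <y, X y> is one more term that the fast
  decay absorbs. The Lyapunov matrix X comes from linear algebra and compactness: uniqueness, proved
  through eigenvectors, gives solvability along a homotopy of Hurwitz matrices, and continuity along
  it carries definiteness from -I to A.\<close>

definition vjoin :: "real^'a \<Rightarrow> real^'b \<Rightarrow> real^('a + 'b)" where
  "vjoin x y = (\<chi> i. case i of Inl a \<Rightarrow> x $ a | Inr b \<Rightarrow> y $ b)"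

text \<open>Opens up an arbitrary vector, so that the simp rules below compute block products
  without touching indices.\<close>

lemma vjoin_cases:
  obtains x y where "z = vjoin x y"
  by (rule that[of "\<chi> a. z $ Inl a" "\<chi> b. z $ Inr b"])
    (simp add: vjoin_def vec_eq_iff split: sum.split)

lemma sum_UNIV_sum:
  "(\<Sum>i\<in>UNIV. f i) = (\<Sum>a\<in>UNIV. f (Inl a)) + (\<Sum>b\<in>UNIV. f (Inr b))"
  for f :: "'a::finite + 'b::finite \<Rightarrow> 'c::comm_monoid_add"
  unfolding UNIV_sum
  by (subst sum.union_disjoint) (auto simp: sum.reindex)

lemma inner_vjoin [simp]: "vjoin x y \<bullet> vjoin x' y' = x \<bullet> x' + y \<bullet> y'"
  by (simp add: vjoin_def inner_vec_def sum_UNIV_sum)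

lemma vjoin_add [simp]: "vjoin x y + vjoin x' y' = vjoin (x + x') (y + y')"
  by (simp add: vjoin_def vec_eq_iff split: sum.split)

lemma vjoin_scaleR [simp]: "c *\<^sub>R vjoin x y = vjoin (c *\<^sub>R x) (c *\<^sub>R y)"
  by (simp add: vjoin_def vec_eq_iff split: sum.split)

lemma vjoin_eq_0_iff [simp]: "vjoin x y = 0 \<longleftrightarrow> x = 0 \<and> y = 0"
  by (auto simp: vjoin_def vec_eq_iff split: sum.split)

lemma hcat_mult_vjoin [simp]: "hcat M N *v vjoin x y = M *v x + N *v y"
  by (simp add: hcat_def vjoin_def vec_eq_iff matrix_vector_mult_def sum_UNIV_sum)

lemma vcat_mult [simp]: "vcat M N *v x = vjoin (M *v x) (N *v x)"
  by (simp add: vcat_def vjoin_def vec_eq_iff matrix_vector_mult_def split: sum.split)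

lemma blk2_mult_vjoin [simp]:
  "blk2 M11 M12 M21 M22 *v vjoin x y = vjoin (M11 *v x + M12 *v y) (M21 *v x + M22 *v y)"
  by (simp add: blk2_def)

lemma transpose_hcat: "transpose (hcat M N) = vcat (transpose M) (transpose N)"
  by (simp add: hcat_def vcat_def vec_eq_iff transpose_def split: sum.split)

lemma transpose_vcat: "transpose (vcat M N) = hcat (transpose M) (transpose N)"
  by (simp add: hcat_def vcat_def vec_eq_iff transpose_def split: sum.split)

lemma transpose_blk2:
  "transpose (blk2 M11 M12 M21 M22)
    = blk2 (transpose M11) (transpose M21) (transpose M12) (transpose M22)"
  by (simp add: blk2_def hcat_def vcat_def vec_eq_iff transpose_def split: sum.split)

lemma transpose_dg3: "transpose (dg3 a b c) = dg3 a b c"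
  by (auto simp: dg3_def transpose_def vec_eq_iff)

lemma dg3_mult_vjoin [simp]:
  "dg3 k1 k2 k3 *v vjoin (vjoin a b) c = vjoin (vjoin (k1 *\<^sub>R a) (k2 *\<^sub>R b)) (k3 *\<^sub>R c)"
proof -
  have *: "(if i = j then t i else (0::real)) * s = (if j = i then t i * s else 0)" for i j t s
    by simp
  show ?thesis
    by (simp add: dg3_def vjoin_def vec_eq_iff matrix_vector_mult_def sum_UNIV_sum * split: sum.split)
qed

lemma transpose_add: "transpose (M + N) = transpose M + transpose (N::'a::plus^'m^'n)"
  by (simp add: vec_eq_iff transpose_def)

lemma transpose_zero [simp]: "transpose 0 = (0::'a::zero^'m^'n)"
  by (simp add: vec_eq_iff transpose_def)

lemma inner_transpose_mult: "x \<bullet> (transpose M *v y) = (M *v x) \<bullet> (y :: real^'m)"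
  by (metis dot_lmul_matrix inner_commute transpose_matrix_vector)

lemma neg_matrix_mult: "(- M) *v x = - (M *v (x :: real^'m))"
  using matrix_vector_mult_diff_rdistrib[of 0 M x] by simp

text \<open>At (z, v) the form of the LMI matrix is the derivative of <z, P z> along z' = A' z + BB
  v plus the multiplier at output and input. From here on the LMI is one scalar inequality.\<close>

lemma LMI_iff_dissipation:
  fixes P :: "real^'x^'x" and BB :: "real^'v^'x" and X :: "real^('v + 'v)^('v + 'v)"
  assumes "transpose P = P" "transpose X = X"
  shows "LMI A' P BB CC X \<longleftrightarrow>
    (\<forall>z v. 2 * (z \<bullet> (P *v (A' *v z + BB *v v))) + vjoin (CC *v z) v \<bullet> (X *v vjoin (CC *v z) v) \<le> 0)"
proof -
  define W :: "real^('x + 'v)^('v + 'v)" where "W = blk2 CC 0 0 (mat 1)"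
  define Q where "Q = blk2 (transpose A' ** P + P ** A') (P ** BB) (transpose BB ** P) 0
    + transpose W ** X ** W"
  \<comment> \<open>Symmetry is part of \<open>neg_semidef\<close>, so it has to be established
    besides the sign of the form.\<close>
  have "transpose Q = Q"
    by (simp add: Q_def transpose_add transpose_blk2 matrix_transpose_mul assms
        matrix_mul_assoc add.commute)
  moreover have "vjoin z v \<bullet> (Q *v vjoin z v) = 2 * (z \<bullet> (P *v (A' *v z + BB *v v)))
      + vjoin (CC *v z) v \<bullet> (X *v vjoin (CC *v z) v)" for z v
  proof -
    have "W *v vjoin z v = vjoin (CC *v z) v" by (simp add: W_def)
    then have "vjoin z v \<bullet> ((transpose W ** X ** W) *v vjoin z v)
        = vjoin (CC *v z) v \<bullet> (X *v vjoin (CC *v z) v)"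
      by (simp add: inner_transpose_mult del: transpose_matrix_vector
          flip: matrix_vector_mul_assoc)
    \<comment> \<open>Symmetry of P makes each term equal to its transposed partner, whence the
      factor 2.\<close>
    moreover have "(P *v z) \<bullet> y = z \<bullet> (P *v y)" for y
      using inner_transpose_mult[of z P y] by (simp add: assms del: transpose_matrix_vector)
    then have "vjoin z v \<bullet> (blk2 (transpose A' ** P + P ** A') (P ** BB) (transpose BB ** P) 0 *v vjoin z v)
        = 2 * (z \<bullet> (P *v (A' *v z + BB *v v)))"
      by (simp add: inner_transpose_mult matrix_vector_mult_add_rdistrib matrix_vector_right_distrib
          inner_add del: transpose_matrix_vector flip: matrix_vector_mul_assoc)
        (simp add: inner_commute)
    ultimately show ?thesis
      unfolding Q_def matrix_vector_mult_add_rdistrib inner_add by simp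
  qed
  ultimately show ?thesis
    unfolding LMI_def neg_semidef_def W_def[symmetric] Q_def[symmetric]
    by (metis vjoin_cases)
qed

section \<open>The Lyapunov equation\<close>

text \<open>This is p(M) v by Horner's scheme; fixing the vector v leaves only matrix-vector
  products and no powers of M.\<close>

definition poly_app :: "complex^'n^'n \<Rightarrow> complex poly \<Rightarrow> complex^'n \<Rightarrow> complex^'n" where
  "poly_app M p v = fold_coeffs (\<lambda>a b. a *s v + M *v b) p 0"

lemma poly_app_0 [simp]: "poly_app M 0 v = 0"
  by (simp add: poly_app_def)

lemma poly_app_pCons [simp]: "poly_app M (pCons a p) v = a *s v + M *v poly_app M p v"
  by (cases "p = 0 \<and> a = 0") (auto simp: poly_app_def)

lemma poly_app_add: "poly_app M (p + q) v = poly_app M p v + poly_app M q v"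
  by (induction p q rule: poly_induct2)
    (simp_all add: vec.scale_left_distrib matrix_vector_right_distrib)

lemma poly_app_smult: "poly_app M (smult c p) v = c *s poly_app M p v"
  by (induction p) (simp_all add: vec.scale_right_distrib vector_scalar_commute)

lemma poly_app_sum: "poly_app M (\<Sum>i\<in>I. p i) v = (\<Sum>i\<in>I. poly_app M (p i) v)"
  by (induction I rule: infinite_finite_induct) (simp_all add: poly_app_add)

lemma poly_app_diff: "poly_app M (p - q) v = poly_app M p v - poly_app M q v"
  using poly_app_add[of M "p - q" q v] by simp

lemma poly_app_in_subspace:
  assumes "vec.subspace W" "\<And>x. x \<in> W \<Longrightarrow> M *v x \<in> W" "v \<in> W"
  shows "poly_app M p v \<in> W"
  by (induction p)
    (simp_all add: assms vec.subspace_0 vec.subspace_add vec.subspace_scale)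

text \<open>The n + 1 vectors v, M v, ..., M^n v are dependent in dimension n, and the coefficients
  of a dependence form the polynomial.\<close>

lemma poly_app_annihilator:
  fixes M :: "complex^'n^'n"
  obtains p where "p \<noteq> 0" "poly_app M p v = 0"
proof (rule ccontr)
  assume "\<not> thesis"
  with that have nz: "poly_app M p v \<noteq> 0" if "p \<noteq> 0" for p using that by blast
  define x where "x i = poly_app M (monom 1 i) v" for i
  \<comment> \<open>Distinctness is needed for S to have n + 1 elements; a coincidence of two
    iterates would itself give an annihilating polynomial.\<close>
  have inj: "inj x"
  proof (rule injI)
    fix i j assume "x i = x j"
    then have "poly_app M (monom 1 i - monom 1 j) v = 0"
      by (simp add: x_def poly_app_diff)
    then show "i = j" using nz[of "monom 1 i - monom 1 j"] by (auto simp: monom_eq_iff')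
  qed
  define S where "S = x ` {..CARD('n)}"
  have fin: "finite S" and card: "card S = CARD('n) + 1"
    using inj by (auto simp: S_def card_image inj_on_subset)
  have "vec.independent S"
  proof (rule vec.independent_if_scalars_zero[OF fin])
    fix f y assume f: "(\<Sum>y\<in>S. f y *s y) = 0" and "y \<in> S"
    then obtain k where k: "k \<le> CARD('n)" "y = x k" by (auto simp: S_def)
    define p where "p = (\<Sum>i\<le>CARD('n). smult (f (x i)) (monom 1 i))"
    have "poly_app M p v = (\<Sum>i\<le>CARD('n). f (x i) *s x i)"
      by (simp only: p_def poly_app_sum poly_app_smult x_def)
    also have "\<dots> = (\<Sum>y\<in>S. f y *s y)"
      unfolding S_def by (subst sum.reindex) (use inj in \<open>auto intro: inj_on_subset\<close>)
    finally have "p = 0" using f nz by auto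
    moreover have "coeff p k = f (x k)"
      using k by (simp add: p_def coeff_sum smult_monom coeff_monom if_distrib cong: if_cong)
    ultimately show "f y = 0" using k by simp
  qed
  then have "card S \<le> CARD('n)"
    using vec.independent_bound_general dim_subset_UNIV_cart_gen by (metis le_trans)
  with card show False by simp
qed

text \<open>Split a root lam off an annihilating polynomial, p = (X - lam) q. Either q(M) v is an
  eigenvector, lying in W by invariance, or q is an annihilator of smaller degree.\<close>

lemma invariant_subspace_eigenvector:
  fixes M :: "complex^'n^'n"
  assumes W: "vec.subspace W" "\<And>x. x \<in> W \<Longrightarrow> M *v x \<in> W" and v: "v \<in> W" "v \<noteq> 0"
  obtains e lam where "e \<in> W" "e \<noteq> 0" "M *v e = lam *s e"
proof -
  have "\<exists>e\<in>W. \<exists>lam. e \<noteq> 0 \<and> M *v e = lam *s e"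
    if "p \<noteq> 0" "poly_app M p v = 0" for p
    using that
  proof (induction "degree p" arbitrary: p rule: less_induct)
    case less
    have "degree p \<noteq> 0"
    proof
      assume "degree p = 0"
      then obtain a where "p = [:a:]" by (rule degree_eq_zeroE)
      with less.prems v show False by simp
    qed
    then obtain lam where "poly p lam = 0"
      using fundamental_theorem_of_algebra[of p] by (auto simp: constant_degree)
    then obtain q where q: "p = [:- lam, 1:] * q" by (auto simp: poly_eq_0_iff_dvd)
    then have q0: "q \<noteq> 0" using less.prems by auto
    have deg: "degree q < degree p" using degree_mult_eq[of "[:- lam, 1:]" q] q q0 by (simp del: mult_pCons_left)
    have "p = smult (- lam) q + pCons 0 q" by (simp add: q)
    then have eq: "M *v poly_app M q v = lam *s poly_app M q v"
      using less.prems(2) by (simp only: poly_app_add poly_app_smult poly_app_pCons) simp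
    show ?case
    proof (cases "poly_app M q v = 0")
      case True
      then show ?thesis using less.hyps[OF deg q0] by blast
    next
      case False
      then show ?thesis using eq poly_app_in_subspace[OF W v(1)] by blast
    qed
  qed
  then show thesis using poly_app_annihilator[of M v] that by metis
qed

section \<open>Uniqueness for the Lyapunov equation\<close>

definition cmat :: "real^'m^'n \<Rightarrow> complex^'m^'n" where
  "cmat M = (\<chi> i j. complex_of_real (M $ i $ j))"

lemma cmat_mult: "cmat (M ** N) = cmat M ** cmat N"
  by (simp add: cmat_def matrix_matrix_mult_def vec_eq_iff)

lemma cmat_add: "cmat (M + N) = cmat M + cmat N"
  by (simp add: cmat_def vec_eq_iff)

lemma cmat_transpose: "cmat (transpose M) = transpose (cmat M)"
  by (simp add: cmat_def vec_eq_iff transpose_def)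

lemma cmat_eq_0_iff [simp]: "cmat M = 0 \<longleftrightarrow> M = 0"
  by (simp add: cmat_def vec_eq_iff)

lemma mat_mult_vec: "mat c *v x = c *s (x :: 'a::comm_semiring_1^'n)"
proof -
  have "(if i = j then c else 0) * x $ j = (if i = j then c * x $ j else 0)" for i j by simp
  then show ?thesis by (simp add: vec_eq_iff matrix_vector_mult_def mat_def)
qed

lemma hurwitzD:
  assumes "hurwitz A" "cmat A *v v = lam *s v" "v \<noteq> 0"
  shows "Re lam < 0"
  using assms unfolding hurwitz_def cmat_def by blast

text \<open>Since A^T X = - X A, the range of X is invariant under A^T and, if X is nonzero,
  contains an eigenvector e = X w with eigenvalue lam. This lam is also an eigenvalue of A, so Re
  lam < 0 and A + lam I is injective. It maps ker X onto itself and sends w into ker X, so w lies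
  there and e = 0.\<close>

lemma lyapunov_injective:
  fixes A X :: "real^'n^'n"
  assumes H: "hurwitz A" and eq: "transpose A ** X + X ** A = 0"
  shows "X = 0"
proof (rule ccontr)
  assume "X \<noteq> 0"
  let ?A = "cmat A" and ?X = "cmat X"
  from \<open>X \<noteq> 0\<close> obtain v where v: "?X *v v \<noteq> 0"
    by (metis cmat_eq_0_iff matrix_eq matrix_vector_mult_0)
  have "transpose ?A ** ?X + ?X ** ?A = 0"
    using arg_cong[OF eq, of cmat] by (simp add: cmat_add cmat_mult cmat_transpose)
  then have comm: "transpose ?A *v (?X *v y) = - (?X *v (?A *v y))" for y
    by (metis eq_neg_iff_add_eq_0 matrix_vector_mul_assoc matrix_vector_mult_0 matrix_vector_mult_add_rdistrib)
  have "vec.subspace (range ((*v) ?X))"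
    by (rule vec.linear_subspace_image) (auto simp: matrix_vector_mul_linear_gen)
  moreover have "transpose ?A *v x \<in> range ((*v) ?X)" if "x \<in> range ((*v) ?X)" for x
  proof -
    obtain y where "x = ?X *v y" using \<open>x \<in> _\<close> by auto
    then have "transpose ?A *v x = ?X *v (- (?A *v y))"
      by (simp only: comm vec.linear_neg[OF matrix_vector_mul_linear_gen])
    then show ?thesis by blast
  qed
  ultimately obtain e lam where e: "e \<in> range ((*v) ?X)" "e \<noteq> 0" "transpose ?A *v e = lam *s e"
    using invariant_subspace_eigenvector[of "range ((*v) ?X)" "transpose ?A" "?X *v v"] v by blast
  then obtain w where w: "e = ?X *v w" by blast
  have "(transpose ?A - mat lam) *v e = 0"
    using e(3) by (simp only: matrix_vector_mult_diff_rdistrib mat_mult_vec) simp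
  then have "\<not> invertible (transpose ?A - mat lam)"
    using e(2) invertible_left_inverse matrix_left_invertible_ker by blast
  \<comment> \<open>Passing from A^T to A through the determinant: both have the same
    eigenvalues.\<close>
  moreover have "transpose (?A - mat lam) = transpose ?A - mat lam"
    by (auto simp: vec_eq_iff transpose_def mat_def)
  ultimately have "\<not> invertible (?A - mat lam)"
    by (metis invertible_det_nz det_transpose)
  then obtain z where "(?A - mat lam) *v z = 0" "z \<noteq> 0"
    using invertible_left_inverse matrix_left_invertible_ker by blast
  then have lam: "Re lam < 0"
    using hurwitzD[OF H] by (simp add: matrix_vector_mult_diff_rdistrib mat_mult_vec)
  define N where "N = ?A + mat lam"
  have N: "N *v y = ?A *v y + lam *s y" for y
    by (simp add: N_def matrix_vector_mult_add_rdistrib mat_mult_vec)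
  \<comment> \<open>A kernel vector would be an eigenvector of A for -lam, whose real part is
    positive.\<close>
  have inj: "inj ((*v) N)"
  proof (rule injI)
    fix x y assume "N *v x = N *v y"
    then have "?A *v (x - y) = (- lam) *s (x - y)"
      by (simp add: N matrix_vector_mult_diff_distrib vec.scale_right_diff_distrib algebra_simps)
    then show "x = y" using hurwitzD[OF H, of "x - y" "- lam"] lam by fastforce
  qed
  define K where "K = {y. ?X *v y = 0}"
  have XN: "?X *v (N *v y) = lam *s (?X *v y) - transpose ?A *v (?X *v y)" for y
    by (simp add: N comm matrix_vector_right_distrib vector_scalar_commute del: transpose_matrix_vector)
  have K: "vec.subspace K"
    by (auto simp: vec.subspace_def K_def matrix_vector_right_distrib vector_scalar_commute)
  have lin: "Vector_Spaces.linear (*s) (*s) ((*v) N)" by (rule matrix_vector_mul_linear_gen)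
  have "(*v) N ` K = K"
  proof (rule vec.subspace_dim_equal)
    show "vec.subspace ((*v) N ` K)" using K lin by (rule vec.linear_subspace_image[rotated])
    show "(*v) N ` K \<subseteq> K" by (auto simp: K_def XN)
    show "vec.dim K \<le> vec.dim ((*v) N ` K)"
      using vec.dim_image_eq[OF lin] inj by (simp add: inj_on_subset)
  qed (rule K)
  \<comment> \<open>Here X (N w) = lam e - A^T e = 0. Since N is injective and maps K onto K, w
    itself is in K.\<close>
  moreover have "N *v w \<in> K" using e by (simp add: K_def XN w)
  ultimately have "w \<in> K" using inj by (metis imageE injD)
  then show False using e w by (simp add: K_def)
qed

section \<open>Existence of a positive definite Lyapunov solution\<close>

lemma matrix_mult_add_rdistrib:
  fixes A B :: "'a::semiring_1^'m^'n"
  shows "(A + B) ** C = A ** C + B ** C"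
  by (simp add: matrix_matrix_mult_def vec_eq_iff sum.distrib distrib_right)

lemma matrix_mult_diff_ldistrib:
  fixes B C :: "'a::ring_1^'m^'n"
  shows "A ** (B - C) = A ** B - A ** C"
  by (simp add: matrix_matrix_mult_def vec_eq_iff sum_subtractf right_diff_distrib)

lemma matrix_mult_diff_rdistrib:
  fixes A B :: "'a::ring_1^'m^'n"
  shows "(A - B) ** C = A ** C - B ** C"
  by (simp add: matrix_matrix_mult_def vec_eq_iff sum_subtractf left_diff_distrib)

lemma quadratic_form_scale:
  fixes M :: "real^'n^'n"
  assumes "x \<noteq> 0"
  shows "x \<bullet> (M *v x) = (norm x)\<^sup>2 * (((1 / norm x) *\<^sub>R x) \<bullet> (M *v ((1 / norm x) *\<^sub>R x)))"
  using assms by (simp add: matrix_vector_mult_scaleR power2_eq_square)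

text \<open>Moving from v in the direction -X v would decrease the form to first order, which is
  impossible at its minimum 0.\<close>

lemma psd_kernel:
  fixes X :: "real^'n^'n"
  assumes sym: "transpose X = X" and psd: "\<And>v. 0 \<le> v \<bullet> (X *v v)" and v: "v \<bullet> (X *v v) = 0"
  shows "X *v v = 0"
proof -
  define w where "w = X *v v"
  define q where "q = w \<bullet> (X *v w)"
  \<comment> \<open>Close to the minimizing step -(w . w) / q; the added 1 keeps the denominator
    positive when q = 0.\<close>
  define s where "s = - (w \<bullet> w) / (1 + q)"
  have q: "0 \<le> q" by (simp add: q_def psd)
  have vw: "v \<bullet> (X *v w) = w \<bullet> w"
    using inner_transpose_mult[of v X w] by (simp add: sym w_def del: transpose_matrix_vector)
  have "(v + s *\<^sub>R w) \<bullet> (X *v (v + s *\<^sub>R w)) = 2 * s * (w \<bullet> w) + s\<^sup>2 * q"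
    using v vw by (simp add: matrix_vector_right_distrib matrix_vector_mult_scaleR inner_add
        power2_eq_square q_def flip: w_def) (simp add: algebra_simps)
  also have "\<dots> = - (w \<bullet> w)\<^sup>2 * (2 + q) / (1 + q)\<^sup>2"
  proof -
    have "2 * (- a / b) * a + (- a / b)\<^sup>2 * q = - a\<^sup>2 * (2 * b - q) / b\<^sup>2" if "b \<noteq> 0" for a b :: real
      using that by (simp add: divide_simps power2_eq_square) (simp add: algebra_simps)
    from this[of "1 + q" "w \<bullet> w"] q show ?thesis by (simp add: s_def)
  qed
  finally have "0 \<le> - (w \<bullet> w)\<^sup>2 * (2 + q) / (1 + q)\<^sup>2" by (metis psd)
  moreover have "0 < (2 + q) / (1 + q)\<^sup>2" using q by simp
  ultimately have "(w \<bullet> w)\<^sup>2 \<le> 0"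
    by (metis (no_types, opaque_lifting) minus_mult_left mult_le_0_iff neg_0_le_iff_le not_less times_divide_eq_right)
  then have "w \<bullet> w = 0" by simp
  then show ?thesis by (simp add: w_def)
qed

text \<open>The eigenvalues are (1 - t) nu - t with nu an eigenvalue of A. For t = 1 no nu can be
  recovered, but the matrix is then -I.\<close>

lemma hurwitz_path:
  assumes H: "hurwitz A" and t: "0 \<le> t" "t \<le> 1"
  shows "hurwitz ((1 - t) *\<^sub>R A - t *\<^sub>R mat 1)"
  unfolding hurwitz_def
proof (intro allI impI, elim conjE)
  fix lam :: complex and v :: "complex^'a"
  assume v: "v \<noteq> 0"
    and eig: "(\<chi> i j. complex_of_real (((1 - t) *\<^sub>R A - t *\<^sub>R mat 1) $ i $ j)) *v v = lam *s v"
  have "(\<chi> i j. complex_of_real (((1 - t) *\<^sub>R A - t *\<^sub>R mat 1) $ i $ j))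
      = mat (complex_of_real (1 - t)) ** cmat A - mat (complex_of_real t)"
    by (auto simp: cmat_def vec_eq_iff mat_def matrix_matrix_mult_def if_distrib if_distribR sum.delta' cong: if_cong)
  with eig have "complex_of_real (1 - t) *s (cmat A *v v) - complex_of_real t *s v = lam *s v"
    by (simp only: matrix_vector_mult_diff_rdistrib mat_mult_vec flip: matrix_vector_mul_assoc)
  then have eq: "complex_of_real (1 - t) *s (cmat A *v v) = (lam + complex_of_real t) *s v"
    by (simp add: algebra_simps)
  show "Re lam < 0"
  proof (cases "t = 1")
    case True
    then have "lam + complex_of_real t = 0" using eq v by (metis of_real_0 right_minus_eq vec.scale_eq_0_iff)
    then have "lam = - complex_of_real t" by (simp add: add_eq_0_iff2)
    then show ?thesis using True by simp
  next
    case False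
    define nu where "nu = (lam + complex_of_real t) / complex_of_real (1 - t)"
    have t1: "complex_of_real (1 - t) \<noteq> 0" using False by (metis of_real_eq_0_iff right_minus_eq)
    have "cmat A *v v = (1 / complex_of_real (1 - t)) *s (complex_of_real (1 - t) *s (cmat A *v v))"
      using t1 by (simp only: vec.scale_scale) simp
    also have "\<dots> = nu *s v" by (simp only: eq vec.scale_scale) (simp only: nu_def times_divide_eq_left mult_1)
    finally have "Re nu < 0" using hurwitzD[OF H] v by blast
    moreover have "Re nu = (Re lam + t) / (1 - t)"
      unfolding nu_def Re_divide_of_real by simp
    ultimately show ?thesis using t False by (simp add: divide_less_0_iff)
  qed
qed

text \<open>The Lyapunov equation is solved along the path \<open>(1 - t) A - t I\<close>. Its solution depends
  continuously on \<open>t\<close>, equals \<open>I / 2\<close> at \<open>t = 1\<close>, and cannot lose definiteness on the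
  way because a vanishing quadratic form would produce a kernel vector.\<close>

lemma lyapunov_exists:
  fixes A :: "real^'n^'n"
  assumes H: "hurwitz A"
  obtains X where "pos_def X" "transpose A ** X + X ** A = - mat 1"
proof -
  define F where "F X = transpose A ** X + X ** A" for X
  \<comment> \<open>The Lyapunov operator of the matrix (1 - t) A - t I, with its identity part
    multiplied out.\<close>
  define L where "L t X = (1 - t) *\<^sub>R F X - (2 * t) *\<^sub>R X" for t X
  have scalar: "(c *\<^sub>R M) ** N = c *\<^sub>R (M ** N)" "M ** (c *\<^sub>R N) = c *\<^sub>R (M ** N)"
    for c and M N :: "real^'n^'n"
    by (simp_all add: scalar_matrix_assoc matrix_scalar_ac)
  have F_lin: "linear F"
    by (rule linearI) (simp_all add: F_def matrix_add_ldistrib matrix_mult_add_rdistrib scalar scaleR_right_distrib)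
  have L_lin: "linear (L t)" for t
    by (rule linearI)
      (simp_all add: L_def linear_add[OF F_lin] linear_scale[OF F_lin] algebra_simps)
  have L0: "X = 0" if "L t X = 0" "t \<in> {0..1}" for t X
  proof -
    define A' where "A' = (1 - t) *\<^sub>R A - t *\<^sub>R mat 1"
    have "transpose A' = (1 - t) *\<^sub>R transpose A - t *\<^sub>R mat 1"
      by (auto simp: A'_def vec_eq_iff transpose_def mat_def)
    then have "transpose A' ** X = (1 - t) *\<^sub>R (transpose A ** X) - t *\<^sub>R X"
      by (simp only: matrix_mult_diff_rdistrib scalar matrix_mul_lid)
    moreover have "X ** A' = (1 - t) *\<^sub>R (X ** A) - t *\<^sub>R X"
      by (simp only: A'_def matrix_mult_diff_ldistrib scalar matrix_mul_rid)
    ultimately have "transpose A' ** X + X ** A'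
        = (1 - t) *\<^sub>R (transpose A ** X) - t *\<^sub>R X + ((1 - t) *\<^sub>R (X ** A) - t *\<^sub>R X)"
      by (simp only:)
    also have "\<dots> = L t X"
      by (simp add: L_def F_def vec_eq_iff algebra_simps)
    finally have "transpose A' ** X + X ** A' = L t X" .
    moreover have "hurwitz A'" unfolding A'_def using H that(2) by (intro hurwitz_path) auto
    ultimately show ?thesis using lyapunov_injective that(1) by metis
  qed
  \<comment> \<open>The transpose solves the same equation, so uniqueness gives symmetry.\<close>
  have sym: "transpose X = X" if "L t X = - mat 1" "t \<in> {0..1}" for t X
  proof -
    have tr: "transpose (F X) = F (transpose X)"
      by (simp add: F_def vec_eq_iff transpose_def matrix_matrix_mult_def mult.commute add.commute)
    have "L t (transpose X) = transpose (L t X)"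
      by (simp add: L_def flip: tr) (simp add: vec_eq_iff transpose_def)
    also have "\<dots> = - mat 1"
      unfolding that(1) by (auto simp: vec_eq_iff transpose_def mat_def)
    finally have "L t (transpose X) = - mat 1" .
    then have "L t (transpose X - X) = 0" using that(1) by (simp add: linear_diff[OF L_lin])
    then show ?thesis using L0 that(2) by (metis right_minus_eq)
  qed
  have F_bl: "bounded_linear F" using F_lin by (simp add: linear_conv_bounded_linear)
  obtain K where K: "0 < K" "\<And>X. norm (F X) \<le> norm X * K"
    using bounded_linear.pos_bounded[OF F_bl] by blast
  \<comment> \<open>Compactness in t and X together turns the injectivity \<open>L0\<close> into a
    lower bound c that is uniform in t; it controls both the size and the variation of the
    solutions.\<close>
  define S where "S = {0..1::real} \<times> sphere (0::real^'n^'n) 1"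
  have "compact S" unfolding S_def by (intro compact_Times) auto
  moreover have "continuous_on S (\<lambda>z. norm (L (fst z) (snd z)))"
    unfolding L_def by (intro continuous_intros bounded_linear.continuous_on[OF F_bl])
  moreover have "S \<noteq> {}"
    by (auto simp: S_def)
  ultimately obtain z where z: "z \<in> S" "\<And>y. y \<in> S \<Longrightarrow> norm (L (fst z) (snd z)) \<le> norm (L (fst y) (snd y))"
    using continuous_attains_inf[of S "\<lambda>z. norm (L (fst z) (snd z))"] by blast
  define c where "c = norm (L (fst z) (snd z))"
  have "c \<noteq> 0" using z(1) L0[of "fst z" "snd z"] by (auto simp: c_def S_def)
  then have c: "0 < c" by (simp add: c_def)
  have lower: "c * norm X \<le> norm (L t X)" if "t \<in> {0..1}" for t X
  proof (cases "X = 0")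
    case False
    then have "c \<le> norm (L t ((1 / norm X) *\<^sub>R X))"
      using z(2)[of "(t, (1 / norm X) *\<^sub>R X)"] that by (simp add: S_def c_def)
    then show ?thesis using False by (simp add: linear_scale[OF L_lin] field_simps)
  qed simp
  have "surj (L t)" if "t \<in> {0..1}" for t
    using that L0 by (intro linear_injective_imp_surjective L_lin) (auto simp: linear_injective_0 L_lin)
  then have "\<forall>t\<in>{0..1}. \<exists>X. L t X = - mat 1" by (metis surj_def)
  then obtain Y where Y: "\<And>t. t \<in> {0..1} \<Longrightarrow> L t (Y t) = - mat 1" by metis
  define N where "N = norm (- mat 1 :: real^'n^'n)"
  have Ybd: "norm (Y t) \<le> N / c" if "t \<in> {0..1}" for t
    using lower[OF that, of "Y t"] Y[OF that] c by (simp add: N_def field_simps)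
  have "((K + 2) * (N / c) / c)-lipschitz_on {0..1} Y"
  proof (rule lipschitz_onI)
    fix t s :: real assume t: "t \<in> {0..1}" and s: "s \<in> {0..1}"
    \<comment> \<open>Both solutions have right-hand side - I, so the difference only sees the
      change of the operator, which is linear in t - s.\<close>
    have "L t (Y t - Y s) = L s (Y s) - L t (Y s)"
      using Y t s by (simp add: linear_diff[OF L_lin])
    also have "\<dots> = (t - s) *\<^sub>R (F (Y s) + 2 *\<^sub>R Y s)"
      by (simp add: L_def algebra_simps)
    finally have *: "c * norm (Y t - Y s) \<le> \<bar>t - s\<bar> * norm (F (Y s) + 2 *\<^sub>R Y s)"
      using lower[OF t, of "Y t - Y s"] by simp
    have "norm (F (Y s) + 2 *\<^sub>R Y s) \<le> norm (Y s) * K + 2 * norm (Y s)"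
      using norm_triangle_ineq[of "F (Y s)" "2 *\<^sub>R Y s"] K(2)[of "Y s"] by simp
    also have "\<dots> = (K + 2) * norm (Y s)" by (simp add: algebra_simps)
    also have "\<dots> \<le> (K + 2) * (N / c)"
      using Ybd[OF s] K by (intro mult_left_mono) auto
    finally have "\<bar>t - s\<bar> * norm (F (Y s) + 2 *\<^sub>R Y s) \<le> \<bar>t - s\<bar> * ((K + 2) * (N / c))"
      by (rule mult_left_mono) simp
    with * have "c * norm (Y t - Y s) \<le> \<bar>t - s\<bar> * ((K + 2) * (N / c))" by (rule order_trans)
    then show "dist (Y t) (Y s) \<le> (K + 2) * (N / c) / c * dist t s"
      using c by (simp add: dist_norm pos_le_divide_eq mult_ac)
  qed (use K c in \<open>auto simp: N_def\<close>)
  then have Ycont: "continuous_on {0..1} Y" by (rule lipschitz_on_continuous_on)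
  have bil: "bounded_bilinear (\<lambda>(M::real^'n^'n) x. M *v x)"
    by (rule bilinear_conv_bounded_bilinear[THEN iffD1])
      (auto simp: bilinear_def intro!: linearI
        simp: matrix_vector_mult_add_rdistrib matrix_vector_right_distrib matrix_vector_mult_scaleR scaleR_matrix_vector_assoc)
  \<comment> \<open>The parameters and unit directions at which definiteness fails; the largest such
    t is examined below.\<close>
  define Z where "Z = ({0..1} \<times> sphere 0 1) \<inter> (\<lambda>z. snd z \<bullet> (Y (fst z) *v snd z)) -` {..0}"
  have cont: "continuous_on ({0..1} \<times> sphere 0 1) (\<lambda>z. snd z \<bullet> (Y (fst z) *v snd z))"
    by (intro continuous_intros bounded_bilinear.continuous_on[OF bil] continuous_on_compose2[OF Ycont]) auto
  have "compact Z"
    unfolding compact_eq_bounded_closed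
  proof
    show "bounded Z" unfolding Z_def
      by (rule bounded_subset[of "{0..1} \<times> sphere 0 1"]) (auto intro: bounded_Times)
    show "closed Z" unfolding Z_def
      by (intro continuous_closed_preimage cont closed_Times) auto
  qed
  have "Z = {}"
  proof (rule ccontr)
    assume "Z \<noteq> {}"
    moreover have "compact (fst ` Z)"
      using \<open>compact Z\<close> by (intro compact_continuous_image continuous_intros)
    ultimately obtain z where z: "z \<in> Z" and max: "\<And>y. y \<in> Z \<Longrightarrow> fst y \<le> fst z"
      using compact_attains_sup[of "fst ` Z"] by blast
    define t v where "t = fst z" and "v = snd z"
    have t: "t \<in> {0..1}" and v: "norm v = 1" and neg: "v \<bullet> (Y t *v v) \<le> 0"
      using z by (auto simp: Z_def t_def v_def)
    have Y1: "Y 1 = (1/2) *\<^sub>R mat 1"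
      using Y[of 1] by (simp add: L_def) (metis (no_types) neg_equal_iff_equal scaleR_half_double scaleR_2 scaleR_left.add one_add_one)
    \<comment> \<open>A negative value at t would rise to 1/2 at parameter 1, hence vanish at some
      later s, against maximality of t.\<close>
    have psd_sphere: "0 \<le> x \<bullet> (Y t *v x)" if "norm x = 1" for x
    proof (rule ccontr)
      assume neg: "\<not> 0 \<le> x \<bullet> (Y t *v x)"
      moreover have "x \<bullet> (Y 1 *v x) = 1/2"
        using that by (simp add: Y1 flip: scaleR_matrix_vector_assoc) (simp add: dot_square_norm)
      moreover have "continuous_on {t..1} (\<lambda>s. x \<bullet> (Y s *v x))"
        using t by (intro continuous_intros bounded_bilinear.continuous_on[OF bil] continuous_on_subset[OF Ycont]) auto
      ultimately obtain s where s: "t \<le> s" "s \<le> 1" "x \<bullet> (Y s *v x) = 0"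
        using IVT'[of "\<lambda>s. x \<bullet> (Y s *v x)" t 0 1] t by auto
      then have "(s, x) \<in> Z" using that t by (auto simp: Z_def)
      then have "s = t" using max s by (force simp: t_def)
      then show False using s neg by simp
    qed
    have psd: "0 \<le> x \<bullet> (Y t *v x)" for x
    proof (cases "x = 0")
      case False
      have n: "norm ((1 / norm x) *\<^sub>R x) = 1" using False by simp
      show ?thesis
        using mult_nonneg_nonneg[OF zero_le_power2 psd_sphere[OF n]]
        by (subst quadratic_form_scale[OF False])
    qed simp
    have Yv: "Y t *v v = 0"
      using neg psd by (intro psd_kernel sym[OF Y] t) (auto intro: order_antisym)
    \<comment> \<open>Every term contains \<open>Y t *v v\<close> = 0, whereas the equation forces
      the value -|v|^2 = -1.\<close>
    have "v \<bullet> (L t (Y t) *v v) = (1 - t) * ((A *v v) \<bullet> (Y t *v v) + v \<bullet> (Y t *v (A *v v))) - 2 * t * (v \<bullet> (Y t *v v))"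
      by (simp add: L_def F_def matrix_vector_mult_add_rdistrib matrix_vector_mult_diff_rdistrib inner_add inner_diff inner_transpose_mult
         del: transpose_matrix_vector flip: scaleR_matrix_vector_assoc matrix_vector_mul_assoc)
    also have "v \<bullet> (Y t *v (A *v v)) = (Y t *v v) \<bullet> (A *v v)"
      using inner_transpose_mult[of v "Y t" "A *v v"] sym[OF Y[OF t] t] by (simp del: transpose_matrix_vector)
    finally have "v \<bullet> (L t (Y t) *v v) = 0" by (simp add: Yv)
    moreover have "(- mat 1) *v v = - v"
      by (metis diff_0 matrix_vector_mul_lid matrix_vector_mult_0 matrix_vector_mult_diff_rdistrib)
    ultimately show False using v by (simp add: Y[OF t] dot_square_norm)
  qed
  have "0 < x \<bullet> (Y 0 *v x)" if "x \<noteq> 0" for x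
  proof -
    have "(0, (1 / norm x) *\<^sub>R x) \<notin> Z" using \<open>Z = {}\<close> by simp
    then have "0 < ((1 / norm x) *\<^sub>R x) \<bullet> (Y 0 *v ((1 / norm x) *\<^sub>R x))"
      using that by (simp add: Z_def)
    moreover have "0 < (norm x)\<^sup>2" using that by simp
    ultimately show ?thesis
      by (subst quadratic_form_scale[OF that]) (rule mult_pos_pos)
  qed
  moreover have "transpose (Y 0) = Y 0" by (rule sym[OF Y]) auto
  ultimately have "pos_def (Y 0)" by (simp add: pos_def_def)
  moreover have "transpose A ** Y 0 + Y 0 ** A = - mat 1"
    using Y[of 0] by (simp add: L_def F_def)
  ultimately show thesis by (rule that)
qed

section \<open>Dissipation inequalities\<close>

text \<open>Cauchy-Schwarz followed by the square of C |x| - 2 \<theta> |y|. The weight on y can be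
  prescribed as small as desired; the price K falls on the variable with decay to spare.\<close>

lemma young_matrix:
  fixes M :: "real^'m^'n"
  assumes "0 < \<theta>"
  obtains K where "0 \<le> K" "\<And>x y. \<bar>x \<bullet> (M *v y)\<bar> \<le> K * (x \<bullet> x) + \<theta> * (y \<bullet> y)"
proof -
  have "bounded_linear ((*v) M)" by (simp add: linear_conv_bounded_linear[symmetric])
  then obtain C where C: "0 < C" "\<And>y. norm (M *v y) \<le> norm y * C"
    using bounded_linear.pos_bounded by blast
  have "\<bar>x \<bullet> (M *v y)\<bar> \<le> C\<^sup>2 / (4 * \<theta>) * (x \<bullet> x) + \<theta> * (y \<bullet> y)" for x y
  proof -
    have "\<bar>x \<bullet> (M *v y)\<bar> \<le> norm x * norm (M *v y)" by (rule Cauchy_Schwarz_ineq2)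
    also have "\<dots> \<le> norm x * (norm y * C)" using C by (intro mult_left_mono) auto
    also have "\<dots> \<le> C\<^sup>2 / (4 * \<theta>) * (norm x)\<^sup>2 + \<theta> * (norm y)\<^sup>2"
    proof -
      have "0 \<le> (C * norm x - 2 * \<theta> * norm y)\<^sup>2 / (4 * \<theta>)" using assms by simp
      also have "\<dots> = C\<^sup>2 / (4 * \<theta>) * (norm x)\<^sup>2 + \<theta> * (norm y)\<^sup>2 - norm x * (norm y * C)"
        using assms by (simp add: field_simps power2_eq_square)
      finally show ?thesis by simp
    qed
    finally show ?thesis by (simp add: dot_square_norm)
  qed
  moreover have "0 \<le> C\<^sup>2 / (4 * \<theta>)" using assms by simp
  ultimately show thesis by (rule that[rotated])
qed

lemma young_matrix_left:
  fixes M :: "real^'m^'n"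
  assumes "0 < \<theta>"
  obtains K where "0 \<le> K" "\<And>x y. \<bar>x \<bullet> (M *v y)\<bar> \<le> \<theta> * (x \<bullet> x) + K * (y \<bullet> y)"
proof -
  obtain K where "0 \<le> K" "\<And>y x. \<bar>y \<bullet> (transpose M *v x)\<bar> \<le> K * (y \<bullet> y) + \<theta> * (x \<bullet> x)"
    using young_matrix[OF assms] by blast
  then show thesis
    by (intro that[of K]) (auto simp: inner_transpose_mult inner_commute add.commute simp del: transpose_matrix_vector)
qed

lemma pos_def_coercive:
  fixes M :: "real^'n^'n"
  assumes "pos_def M"
  obtains c where "0 < c" "\<And>x. c * (x \<bullet> x) \<le> x \<bullet> (M *v x)"
proof -
  have "bounded_linear ((*v) M)" by (simp add: linear_conv_bounded_linear[symmetric])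
  then have "continuous_on (sphere 0 1) (\<lambda>x. x \<bullet> (M *v x))"
    by (intro continuous_intros bounded_linear.continuous_on)
  moreover have "sphere (0::real^'n) 1 \<noteq> {}" by simp
  ultimately obtain e where e: "e \<in> sphere 0 1"
    and min: "\<And>y. y \<in> sphere 0 1 \<Longrightarrow> e \<bullet> (M *v e) \<le> y \<bullet> (M *v y)"
    using continuous_attains_inf[of "sphere 0 1" "\<lambda>x. x \<bullet> (M *v x)"] compact_sphere by blast
  have "e \<noteq> 0" using e by auto
  then have "0 < e \<bullet> (M *v e)" using assms by (simp add: pos_def_def)
  moreover have "e \<bullet> (M *v e) * (x \<bullet> x) \<le> x \<bullet> (M *v x)" for x
  proof (cases "x = 0")
    case False
    then have "e \<bullet> (M *v e) \<le> ((1 / norm x) *\<^sub>R x) \<bullet> (M *v ((1 / norm x) *\<^sub>R x))"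
      by (intro min) simp
    then show ?thesis using False
      by (simp add: matrix_vector_mult_scaleR dot_square_norm pos_le_divide_eq power2_eq_square mult_ac)
  qed simp
  ultimately show thesis by (rule that)
qed

text \<open>The coefficient collects -\<mu> from the storage and \<phi> L from the multiplier. It
  vanishes for \<phi> = \<mu> / L; for L = 0 a large \<phi> lets the term in b dominate
  instead.\<close>

lemma sector_multiplier:
  fixes E :: "real^'m^'n"
  assumes "0 \<le> L" "0 < \<mu>" "0 < \<theta>"
  obtains \<phi> where "0 < \<phi>"
    "\<And>u b. (\<phi> * L - \<mu>) * ((E *v u) \<bullet> b) \<le> \<theta> * (u \<bullet> u) + \<phi> / 2 * (b \<bullet> b)"
proof (cases "L = 0")
  case False
  with assms have "\<mu> / L * L - \<mu> = 0" by simp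
  then show thesis
    using assms False by (intro that[of "\<mu> / L"]) (simp_all only: mult_zero_left, simp_all)
next
  case True
  obtain K where K: "0 \<le> K" "\<And>b u. \<bar>b \<bullet> ((\<mu> *\<^sub>R E) *v u)\<bar> \<le> K * (b \<bullet> b) + \<theta> * (u \<bullet> u)"
    using young_matrix[OF assms(3)] by blast
  show thesis
  proof (rule that[of "2 * K + 1"])
    fix u b
    have "(b \<bullet> ((\<mu> *\<^sub>R E) *v u)) = \<mu> * ((E *v u) \<bullet> b)"
      by (simp add: inner_commute flip: scaleR_matrix_vector_assoc)
    then have "- (\<mu> * ((E *v u) \<bullet> b)) \<le> K * (b \<bullet> b) + \<theta> * (u \<bullet> u)"
      using K(2)[of b u] by linarith
    moreover have "K * (b \<bullet> b) \<le> (2 * K + 1) / 2 * (b \<bullet> b)"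
      by (intro mult_right_mono) auto
    ultimately show "((2 * K + 1) * L - \<mu>) * ((E *v u) \<bullet> b) \<le> \<theta> * (u \<bullet> u) + (2 * K + 1) / 2 * (b \<bullet> b)"
      by (simp add: True)
  qed (use K in simp)
qed

section \<open>Slow and full dissipation estimates\<close>

lemma slow_dissipation:
  fixes T :: "real^'p^'r2" and E :: "real^'p^'r1"
  assumes m: "0 < m" and mu: "0 < \<mu>" and Lf: "0 \<le> Lf" and Lh: "0 \<le> Lh"
    and T: "pos_def (T ** transpose T)"
  obtains \<phi>1 \<phi>2 \<beta> \<delta> where "0 < \<phi>1" "0 < \<phi>2" "0 < \<beta>" "0 < \<delta>"
    "\<And>u l. \<bar>2 * \<beta> * (l \<bullet> (T *v u))\<bar> \<le> \<mu> / 2 * (u \<bullet> u + l \<bullet> l)"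
    "\<And>u l a b c du dl. du = - (m *\<^sub>R u) - a - transpose E *v b - (1 / \<mu>) *\<^sub>R (transpose T *v c) \<Longrightarrow>
      dl = c - \<mu> *\<^sub>R l \<Longrightarrow>
      \<mu> * (u \<bullet> du) + \<beta> * (l \<bullet> (T *v du) + dl \<bullet> (T *v u)) + \<mu> * (l \<bullet> dl)
      + \<phi>1 * Lf * (u \<bullet> a) + \<phi>2 * Lh * ((E *v u) \<bullet> b) + (T *v u + \<mu> *\<^sub>R l) \<bullet> c
      - \<phi>1 * (a \<bullet> a) - \<phi>2 * (b \<bullet> b) - c \<bullet> c
      \<le> - \<delta> * (u \<bullet> u + l \<bullet> l + a \<bullet> a + b \<bullet> b + c \<bullet> c)"
proof -
  \<comment> \<open>Each of the two sector couplings may use a quarter of the decay \<mu> m of u;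
    half of it survives.\<close>
  have m4: "0 < \<mu> * m / 4" using m mu by simp
  obtain \<phi>1 where f1: "0 < \<phi>1"
    "\<And>u a. (\<phi>1 * Lf - \<mu>) * ((mat 1 *v u) \<bullet> (a :: real^'p)) \<le> \<mu> * m / 4 * (u \<bullet> u) + \<phi>1 / 2 * (a \<bullet> a)"
    using sector_multiplier[OF Lf mu m4] by blast
  obtain \<phi>2 where f2: "0 < \<phi>2"
    "\<And>u b. (\<phi>2 * Lh - \<mu>) * ((E *v u) \<bullet> b) \<le> \<mu> * m / 4 * (u \<bullet> u) + \<phi>2 / 2 * (b \<bullet> b)"
    using sector_multiplier[OF Lh mu m4] by blast
  obtain \<sigma> where s: "0 < \<sigma>" "\<And>l. \<sigma> * (l \<bullet> l) \<le> l \<bullet> ((T ** transpose T) *v l)"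
    using pos_def_coercive[OF T] by blast
  \<comment> \<open>Four couplings involve l, each at the cost \<sigma> / 8, so half of the
    coercivity constant of T T^T remains.\<close>
  have s8: "0 < \<sigma> / 8" using s by simp
  obtain K0 where K0: "0 \<le> K0" "\<And>l u. \<bar>l \<bullet> (T *v u)\<bar> \<le> 1 * (l \<bullet> l) + K0 * (u \<bullet> u)"
    using young_matrix_left[of 1 T] by auto
  obtain K1 where K1: "0 \<le> K1" "\<And>l d. \<bar>l \<bullet> (((1/\<mu>) *\<^sub>R (T ** transpose T)) *v d)\<bar> \<le> \<sigma> / 8 * (l \<bullet> l) + K1 * (d \<bullet> d)"
    using young_matrix_left[OF s8] by blast
  obtain K2 where K2: "0 \<le> K2" "\<And>l u. \<bar>l \<bullet> ((m *\<^sub>R T) *v u)\<bar> \<le> \<sigma> / 8 * (l \<bullet> l) + K2 * (u \<bullet> u)"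
    using young_matrix_left[OF s8] by blast
  obtain K3 where K3: "0 \<le> K3" "\<And>l a. \<bar>l \<bullet> (T *v a)\<bar> \<le> \<sigma> / 8 * (l \<bullet> l) + K3 * (a \<bullet> a)"
    using young_matrix_left[OF s8] by blast
  obtain K4 where K4: "0 \<le> K4" "\<And>l b. \<bar>l \<bullet> ((T ** transpose E) *v b)\<bar> \<le> \<sigma> / 8 * (l \<bullet> l) + K4 * (b \<bullet> b)"
    using young_matrix_left[OF s8] by blast
  define K where "K = K0 + K1 + K2 + K3 + K4 + 1"
  \<comment> \<open>The first four entries are the decay rates of u, a, b and dl left at \<beta> =
    0; the entry \<mu> serves the bound on the storage cross term.\<close>
  define c where "c = Min {\<mu> * m / 2, \<phi>1 / 2, \<phi>2 / 2, 1, \<mu>}"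
  have c: "0 < c" "c \<le> \<mu> * m / 2" "c \<le> \<phi>1 / 2" "c \<le> \<phi>2 / 2" "c \<le> 1" "c \<le> \<mu>"
    using m mu f1 f2 by (auto simp: c_def)
  have K: "1 \<le> K" "K0 \<le> K" using K0 K1 K2 K3 K4 by (auto simp: K_def)
  \<comment> \<open>With \<beta> K = c / 4 the perturbation takes only a quarter of the decay
    c.\<close>
  define \<beta> where "\<beta> = c / (4 * K)"
  have b: "0 < \<beta>" "\<beta> * K = c / 4" using c K by (auto simp: \<beta>_def)
  \<comment> \<open>The factor 1 + 2 \<mu>^2 pays for l . l itself and for its share in the bound of
    c . c by l . l and dl . dl.\<close>
  define \<delta> where "\<delta> = min (c / 4) (\<beta> * \<sigma> / 2 / (1 + 2 * \<mu>\<^sup>2))"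
  have q: "0 < 1 + 2 * \<mu>\<^sup>2" by (simp add: add_pos_nonneg)
  have "0 < \<beta> * \<sigma> / 2 / (1 + 2 * \<mu>\<^sup>2)" using b(1) s(1) q by (intro divide_pos_pos mult_pos_pos) auto
  then have d: "0 < \<delta>" "\<delta> \<le> c / 4" using c(1) unfolding \<delta>_def by (simp, intro min.cobounded1)
  have "\<delta> \<le> \<beta> * \<sigma> / 2 / (1 + 2 * \<mu>\<^sup>2)" unfolding \<delta>_def by (rule min.cobounded2)
  then have d3: "\<delta> * (1 + 2 * \<mu>\<^sup>2) \<le> \<beta> * \<sigma> / 2" using q by (simp only: pos_le_divide_eq)
  show thesis
  proof (rule that[OF f1(1) f2(1) b(1) d(1)])
    fix u l
    have "\<bar>2 * \<beta> * (l \<bullet> (T *v u))\<bar> = 2 * \<beta> * \<bar>l \<bullet> (T *v u)\<bar>" using b by (simp add: abs_mult)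
    also have "\<dots> \<le> 2 * \<beta> * (K * (l \<bullet> l) + K * (u \<bullet> u))"
    proof (rule mult_left_mono)
      have "1 * (l \<bullet> l) \<le> K * (l \<bullet> l)" "K0 * (u \<bullet> u) \<le> K * (u \<bullet> u)"
        by (rule mult_right_mono; use K in simp)+
      then show "\<bar>l \<bullet> (T *v u)\<bar> \<le> K * (l \<bullet> l) + K * (u \<bullet> u)" using K0(2)[of l u] by linarith
    qed (use b in simp)
    also have "\<dots> = 2 * (\<beta> * K) * (u \<bullet> u + l \<bullet> l)" by (simp add: algebra_simps)
    also have "\<dots> \<le> \<mu> / 2 * (u \<bullet> u + l \<bullet> l)"
      unfolding b using c by (intro mult_right_mono) auto
    finally show "\<bar>2 * \<beta> * (l \<bullet> (T *v u))\<bar> \<le> \<mu> / 2 * (u \<bullet> u + l \<bullet> l)" .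
  next
    fix u l a b' cc du dl
    assume du: "du = - (m *\<^sub>R u) - a - transpose E *v b' - (1 / \<mu>) *\<^sub>R (transpose T *v cc)"
      and dl: "dl = cc - \<mu> *\<^sub>R l"
    let ?TT = "T ** transpose T"
    \<comment> \<open>Using dl instead of the input as independent variable makes the terms in l and
      dl collapse to -|dl|^2.\<close>
    have cc: "cc = \<mu> *\<^sub>R l + dl" by (simp add: dl)
    have Eu: "u \<bullet> (transpose E *v b') = (E *v u) \<bullet> b'" and Tu: "u \<bullet> (transpose T *v cc) = (T *v u) \<bullet> cc"
      by (rule inner_transpose_mult)+
    have udu: "\<mu> * (u \<bullet> du) = - \<mu> * m * (u \<bullet> u) - \<mu> * (u \<bullet> a) - \<mu> * ((E *v u) \<bullet> b') - (T *v u) \<bullet> cc"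
      unfolding du inner_diff_right inner_minus_right inner_scaleR_right Eu Tu
      using mu by (simp add: algebra_simps)
    have "T *v du = - (m *\<^sub>R (T *v u)) - T *v a - (T ** transpose E) *v b' - (1 / \<mu>) *\<^sub>R (?TT *v cc)"
      unfolding du by (simp add: matrix_vector_mult_diff_distrib matrix_vector_mult_scaleR
          del: transpose_matrix_vector flip: matrix_vector_mul_assoc)
        (metis diff_0 matrix_vector_mult_0_right matrix_vector_mult_diff_distrib matrix_vector_mult_scaleR scaleR_minus_left)
    also have "?TT *v cc = \<mu> *\<^sub>R (?TT *v l) + ?TT *v dl"
      by (simp only: cc matrix_vector_right_distrib matrix_vector_mult_scaleR)
    finally have Tdu: "T *v du = - (m *\<^sub>R (T *v u)) - T *v a - (T ** transpose E) *v b'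
        - (1 / \<mu>) *\<^sub>R (\<mu> *\<^sub>R (?TT *v l) + ?TT *v dl)" .
    have lTdu: "l \<bullet> (T *v du) = - m * (l \<bullet> (T *v u)) - l \<bullet> (T *v a) - l \<bullet> ((T ** transpose E) *v b')
        - l \<bullet> (?TT *v l) - l \<bullet> (((1/\<mu>) *\<^sub>R ?TT) *v dl)"
      unfolding Tdu using mu
      by (simp add: inner_diff_right inner_add_right distrib_left flip: scaleR_matrix_vector_assoc)
    have ccs: "cc \<bullet> cc = \<mu>\<^sup>2 * (l \<bullet> l) + 2 * \<mu> * (l \<bullet> dl) + dl \<bullet> dl"
      unfolding cc by (simp add: inner_add inner_commute power2_eq_square algebra_simps)
    have lcc: "l \<bullet> cc = \<mu> * (l \<bullet> l) + l \<bullet> dl"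
      unfolding cc by (simp add: inner_add_right)
    let ?F = "\<mu> * (u \<bullet> du) + \<beta> * (l \<bullet> (T *v du) + dl \<bullet> (T *v u)) + \<mu> * (l \<bullet> dl)
      + \<phi>1 * Lf * (u \<bullet> a) + \<phi>2 * Lh * ((E *v u) \<bullet> b') + (T *v u + \<mu> *\<^sub>R l) \<bullet> cc
      - \<phi>1 * (a \<bullet> a) - \<phi>2 * (b' \<bullet> b') - cc \<bullet> cc"
    define R where "R = dl \<bullet> (T *v u) - l \<bullet> (?TT *v l) - l \<bullet> (((1/\<mu>) *\<^sub>R ?TT) *v dl)
        - l \<bullet> ((m *\<^sub>R T) *v u) - l \<bullet> (T *v a) - l \<bullet> ((T ** transpose E) *v b')"
    have R_le: "R \<le> K * (u \<bullet> u + a \<bullet> a + b' \<bullet> b' + dl \<bullet> dl) - \<sigma> / 2 * (l \<bullet> l)"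
    proof -
      have "(K0 + K2) * (u \<bullet> u) \<le> K * (u \<bullet> u)" "K3 * (a \<bullet> a) \<le> K * (a \<bullet> a)"
        "K4 * (b' \<bullet> b') \<le> K * (b' \<bullet> b')" "(K1 + 1) * (dl \<bullet> dl) \<le> K * (dl \<bullet> dl)"
        by (rule mult_right_mono; use K0 K1 K2 K3 K4 in \<open>simp add: K_def\<close>)+
      then show ?thesis
        using K0(2)[of dl u] K1(2)[of l dl] K2(2)[of l u] K3(2)[of l a] K4(2)[of l b'] s(2)[of l]
        unfolding R_def by (simp add: distrib_left distrib_right)
    qed
    have "?F = - \<mu> * m * (u \<bullet> u) + (\<phi>1 * Lf - \<mu>) * (u \<bullet> a) + (\<phi>2 * Lh - \<mu>) * ((E *v u) \<bullet> b')
      - \<phi>1 * (a \<bullet> a) - \<phi>2 * (b' \<bullet> b') - dl \<bullet> dl + \<beta> * R"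
      unfolding udu lTdu ccs R_def
      by (simp add: inner_add_left lcc flip: scaleR_matrix_vector_assoc)
        (simp add: algebra_simps power2_eq_square)
    also have "\<dots> \<le> - c * (u \<bullet> u + a \<bullet> a + b' \<bullet> b' + dl \<bullet> dl) + \<beta> * R"
    proof -
      have "c * (u \<bullet> u) \<le> \<mu> * m / 2 * (u \<bullet> u)" "c * (a \<bullet> a) \<le> \<phi>1 / 2 * (a \<bullet> a)"
        "c * (b' \<bullet> b') \<le> \<phi>2 / 2 * (b' \<bullet> b')" "c * (dl \<bullet> dl) \<le> 1 * (dl \<bullet> dl)"
        by (rule mult_right_mono; use c in simp)+
      then show ?thesis
        using f1(2)[of u a] f2(2)[of u b'] by (simp add: algebra_simps)
    qed
    also have "\<dots> \<le> - c * (u \<bullet> u + a \<bullet> a + b' \<bullet> b' + dl \<bullet> dl)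
        + \<beta> * (K * (u \<bullet> u + a \<bullet> a + b' \<bullet> b' + dl \<bullet> dl) - \<sigma> / 2 * (l \<bullet> l))"
      using R_le b(1) by simp
    also have "\<dots>
      = - (3 * c / 4) * (u \<bullet> u + a \<bullet> a + b' \<bullet> b' + dl \<bullet> dl) - \<beta> * \<sigma> / 2 * (l \<bullet> l)"
    proof -
      have c4: "c = 4 * (\<beta> * K)" using b by simp
      show ?thesis unfolding c4 by (simp add: algebra_simps)
    qed
    also have "\<dots> \<le> - \<delta> * (u \<bullet> u + l \<bullet> l + a \<bullet> a + b' \<bullet> b' + cc \<bullet> cc)"
    proof -
      have "0 \<le> (\<mu> *\<^sub>R l - dl) \<bullet> (\<mu> *\<^sub>R l - dl)" by simp
      then have "cc \<bullet> cc \<le> 2 * \<mu>\<^sup>2 * (l \<bullet> l) + 2 * (dl \<bullet> dl)"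
        unfolding ccs by (simp add: inner_diff inner_commute power2_eq_square algebra_simps)
      then have "\<delta> * (u \<bullet> u + l \<bullet> l + a \<bullet> a + b' \<bullet> b' + cc \<bullet> cc)
          \<le> \<delta> * (u \<bullet> u + l \<bullet> l + a \<bullet> a + b' \<bullet> b' + (2 * \<mu>\<^sup>2 * (l \<bullet> l) + 2 * (dl \<bullet> dl)))"
        using d by (intro mult_left_mono) auto
      also have "\<dots> = \<delta> * (u \<bullet> u) + \<delta> * (a \<bullet> a) + \<delta> * (b' \<bullet> b') + 2 * \<delta> * (dl \<bullet> dl) + \<delta> * (1 + 2 * \<mu>\<^sup>2) * (l \<bullet> l)"
        by (simp add: algebra_simps)
      also have "\<dots> \<le> 3 * c / 4 * (u \<bullet> u) + 3 * c / 4 * (a \<bullet> a) + 3 * c / 4 * (b' \<bullet> b') + 3 * c / 4 * (dl \<bullet> dl)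
          + \<beta> * \<sigma> / 2 * (l \<bullet> l)"
        using c d d3 by (intro add_mono mult_right_mono) auto
      finally show ?thesis by (simp only: distrib_left mult_minus_left)
    qed
    finally show "?F \<le> - \<delta> * (u \<bullet> u + l \<bullet> l + a \<bullet> a + b' \<bullet> b' + cc \<bullet> cc)" .
  qed
qed

text \<open>Each of the six couplings with y costs \<delta> / 8 of a slow variable and a multiple of
  |y|^2 that does not depend on \<epsilon>, so \<epsilon> can be chosen last.\<close>

lemma full_dissipation:
  fixes A X :: "real^'n^'n" and G :: "real^'p^'n" and C1 :: "real^'n^'r1" and C2 :: "real^'n^'r2"
    and T :: "real^'p^'r2" and E :: "real^'p^'r1"
  assumes m: "0 < m" and mu: "0 < \<mu>" and Lf: "0 \<le> Lf" and Lh: "0 \<le> Lh"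
    and T: "pos_def (T ** transpose T)"
    and X: "transpose X = X" "transpose A ** X + X ** A = - mat 1"
  obtains \<epsilon> \<rho> \<phi>1 \<phi>2 \<beta> where "0 < \<epsilon>" "0 < \<rho>" "0 < \<phi>1" "0 < \<phi>2" "0 < \<beta>"
    "\<And>u l. \<bar>2 * \<beta> * (l \<bullet> (T *v u))\<bar> \<le> \<mu> / 2 * (u \<bullet> u + l \<bullet> l)"
    "\<And>y u l a b c du dl. du = - (m *\<^sub>R u) - a - transpose E *v b - (1 / \<mu>) *\<^sub>R (transpose T *v c) \<Longrightarrow>
      dl = c - \<mu> *\<^sub>R l \<Longrightarrow>
      y \<bullet> (X *v ((1 / \<epsilon>) *\<^sub>R (A *v y) + G *v du))
      + \<mu> * (u \<bullet> du) + \<beta> * (l \<bullet> (T *v du) + dl \<bullet> (T *v u)) + \<mu> * (l \<bullet> dl)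
      + \<rho> * (y \<bullet> (X *v y) + \<mu> * (u \<bullet> u) + 2 * \<beta> * (l \<bullet> (T *v u)) + \<mu> * (l \<bullet> l))
      + \<phi>1 * Lf * (u \<bullet> a) + \<phi>2 * Lh * ((C1 *v y + E *v u) \<bullet> b) + (C2 *v y + T *v u + \<mu> *\<^sub>R l) \<bullet> c
      - \<phi>1 * (a \<bullet> a) - \<phi>2 * (b \<bullet> b) - c \<bullet> c \<le> 0"
proof -
  obtain \<phi>1 \<phi>2 \<beta> \<delta> where pos: "0 < \<phi>1" "0 < \<phi>2" "0 < \<beta>" "0 < \<delta>"
    and cross: "\<And>u l. \<bar>2 * \<beta> * (l \<bullet> (T *v u))\<bar> \<le> \<mu> / 2 * (u \<bullet> u + l \<bullet> l)"
    and slow: "\<And>u l a b c du dl. du = - (m *\<^sub>R u) - a - transpose E *v b - (1 / \<mu>) *\<^sub>R (transpose T *v c) \<Longrightarrow>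
      dl = c - \<mu> *\<^sub>R l \<Longrightarrow>
      \<mu> * (u \<bullet> du) + \<beta> * (l \<bullet> (T *v du) + dl \<bullet> (T *v u)) + \<mu> * (l \<bullet> dl)
      + \<phi>1 * Lf * (u \<bullet> a) + \<phi>2 * Lh * ((E *v u) \<bullet> b) + (T *v u + \<mu> *\<^sub>R l) \<bullet> c
      - \<phi>1 * (a \<bullet> a) - \<phi>2 * (b \<bullet> b) - c \<bullet> c
      \<le> - \<delta> * (u \<bullet> u + l \<bullet> l + a \<bullet> a + b \<bullet> b + c \<bullet> c)"
    by (rule slow_dissipation[OF m mu Lf Lh T], rule that, assumption+)
  have d8: "0 < \<delta> / 8" using pos by simp
  define XG where "XG = X ** G"
  obtain K0 where K0: "0 \<le> K0" "\<And>x y. \<bar>x \<bullet> (X *v y)\<bar> \<le> K0 * (x \<bullet> x) + 1 * (y \<bullet> y)"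
    using young_matrix[OF zero_less_one] by blast
  obtain K1 where K1: "0 \<le> K1" "\<And>y u. \<bar>y \<bullet> ((m *\<^sub>R XG) *v u)\<bar> \<le> K1 * (y \<bullet> y) + \<delta> / 8 * (u \<bullet> u)"
    using young_matrix[OF d8] by blast
  obtain K2 where K2: "0 \<le> K2" "\<And>y a. \<bar>y \<bullet> (XG *v a)\<bar> \<le> K2 * (y \<bullet> y) + \<delta> / 8 * (a \<bullet> a)"
    using young_matrix[OF d8] by blast
  obtain K3 where K3: "0 \<le> K3" "\<And>y b. \<bar>y \<bullet> ((XG ** transpose E) *v b)\<bar> \<le> K3 * (y \<bullet> y) + \<delta> / 8 * (b \<bullet> b)"
    using young_matrix[OF d8] by blast
  obtain K4 where K4: "0 \<le> K4" "\<And>y c. \<bar>y \<bullet> (((1 / \<mu>) *\<^sub>R (XG ** transpose T)) *v c)\<bar> \<le> K4 * (y \<bullet> y) + \<delta> / 8 * (c \<bullet> c)"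
    using young_matrix[OF d8] by blast
  obtain K5 where K5: "0 \<le> K5" "\<And>y b. \<bar>y \<bullet> (((\<phi>2 * Lh) *\<^sub>R transpose C1) *v b)\<bar> \<le> K5 * (y \<bullet> y) + \<delta> / 8 * (b \<bullet> b)"
    using young_matrix[OF d8] by blast
  obtain K6 where K6: "0 \<le> K6" "\<And>y c. \<bar>y \<bullet> (transpose C2 *v c)\<bar> \<le> K6 * (y \<bullet> y) + \<delta> / 8 * (c \<bullet> c)"
    using young_matrix[OF d8] by blast
  \<comment> \<open>By \<open>cross\<close> the slow storage is at most 3 \<mu> / 2 times |u|^2 +
    |l|^2, so it costs exactly \<delta> / 4.\<close>
  define \<rho> where "\<rho> = \<delta> / (6 * \<mu>)"
  define K where "K = K1 + K2 + K3 + K4 + K5 + K6 + \<rho> * (K0 + 1)"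
  \<comment> \<open>The Lyapunov equation yields <y, X A y> = -|y|^2 / 2; this choice turns it into
    -(K + 1) |y|^2.\<close>
  define \<epsilon> where "\<epsilon> = 1 / (2 * (K + 1))"
  have rho: "0 < \<rho>" "\<rho> * (3 * \<mu> / 2) = \<delta> / 4" using pos mu by (simp_all add: \<rho>_def)
  have K: "0 \<le> K" using K0 K1 K2 K3 K4 K5 K6 rho by (simp add: K_def)
  then have eps: "0 < \<epsilon>" "1 / \<epsilon> = 2 * (K + 1)" by (simp_all add: \<epsilon>_def)
  show thesis
  proof (rule that[OF eps(1) rho(1) pos(1,2,3) cross])
    fix y :: "real^'n" and u a du :: "real^'p" and l c dl :: "real^'r2" and b :: "real^'r1"
    assume du: "du = - (m *\<^sub>R u) - a - transpose E *v b - (1 / \<mu>) *\<^sub>R (transpose T *v c)"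
      and dl: "dl = c - \<mu> *\<^sub>R l"
    define S where "S = \<mu> * (u \<bullet> du) + \<beta> * (l \<bullet> (T *v du) + dl \<bullet> (T *v u)) + \<mu> * (l \<bullet> dl)
      + \<phi>1 * Lf * (u \<bullet> a) + \<phi>2 * Lh * ((E *v u) \<bullet> b) + (T *v u + \<mu> *\<^sub>R l) \<bullet> c
      - \<phi>1 * (a \<bullet> a) - \<phi>2 * (b \<bullet> b) - c \<bullet> c"
    have S: "S \<le> - \<delta> * (u \<bullet> u + l \<bullet> l + a \<bullet> a + b \<bullet> b + c \<bullet> c)"
      unfolding S_def by (rule slow[OF du dl])
    have "y \<bullet> ((transpose A ** X + X ** A) *v y) = 2 * (y \<bullet> (X *v (A *v y)))"
      using inner_transpose_mult[of y X "A *v y"]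
      by (simp add: matrix_vector_mult_add_rdistrib inner_add inner_transpose_mult X(1) inner_commute
          del: transpose_matrix_vector flip: matrix_vector_mul_assoc)
    then have "y \<bullet> (X *v (A *v y)) = - (y \<bullet> y) / 2"
      unfolding X(2) by (simp add: neg_matrix_mult)
    then have fast: "y \<bullet> (X *v ((1 / \<epsilon>) *\<^sub>R (A *v y))) = - (K + 1) * (y \<bullet> y)"
      unfolding matrix_vector_mult_scaleR inner_scaleR_right eps(2) by (simp add: algebra_simps)
    have "XG *v du = - ((m *\<^sub>R XG) *v u) - XG *v a - (XG ** transpose E) *v b - ((1 / \<mu>) *\<^sub>R (XG ** transpose T)) *v c"
      unfolding du
      by (simp add: matrix_vector_mult_diff_distrib matrix_vector_mult_scaleR
          del: transpose_matrix_vector flip: matrix_vector_mul_assoc scaleR_matrix_vector_assoc)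
        (metis diff_0 matrix_vector_mult_0_right matrix_vector_mult_diff_distrib matrix_vector_mult_scaleR scaleR_minus_left)
    then have couple: "y \<bullet> (X *v (G *v du)) = - (y \<bullet> ((m *\<^sub>R XG) *v u)) - y \<bullet> (XG *v a)
        - y \<bullet> ((XG ** transpose E) *v b) - y \<bullet> (((1 / \<mu>) *\<^sub>R (XG ** transpose T)) *v c)"
      by (simp add: XG_def inner_diff_right matrix_vector_mul_assoc)
    have outputs: "\<phi>2 * Lh * ((C1 *v y) \<bullet> b) = y \<bullet> (((\<phi>2 * Lh) *\<^sub>R transpose C1) *v b)"
      "(C2 *v y) \<bullet> c = y \<bullet> (transpose C2 *v c)"
      by (simp_all add: inner_transpose_mult del: transpose_matrix_vector flip: scaleR_matrix_vector_assoc)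
    have storage: "\<rho> * (y \<bullet> (X *v y) + \<mu> * (u \<bullet> u) + 2 * \<beta> * (l \<bullet> (T *v u)) + \<mu> * (l \<bullet> l))
        \<le> \<rho> * (K0 + 1) * (y \<bullet> y) + \<delta> / 4 * (u \<bullet> u + l \<bullet> l)"
    proof -
      have "y \<bullet> (X *v y) + \<mu> * (u \<bullet> u) + 2 * \<beta> * (l \<bullet> (T *v u)) + \<mu> * (l \<bullet> l)
          \<le> (K0 + 1) * (y \<bullet> y) + 3 * \<mu> / 2 * (u \<bullet> u + l \<bullet> l)"
      proof -
        have "\<mu> * (u \<bullet> u) + \<mu> * (l \<bullet> l) = \<mu> * (u \<bullet> u + l \<bullet> l)"
          "3 * \<mu> / 2 * (u \<bullet> u + l \<bullet> l) = \<mu> * (u \<bullet> u + l \<bullet> l) + \<mu> / 2 * (u \<bullet> u + l \<bullet> l)"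
          "(K0 + 1) * (y \<bullet> y) = K0 * (y \<bullet> y) + 1 * (y \<bullet> y)"
          by (simp_all add: field_simps)
        then show ?thesis using K0(2)[of y y] cross[of l u] by linarith
      qed
      then have "\<rho> * (y \<bullet> (X *v y) + \<mu> * (u \<bullet> u) + 2 * \<beta> * (l \<bullet> (T *v u)) + \<mu> * (l \<bullet> l))
          \<le> \<rho> * ((K0 + 1) * (y \<bullet> y) + 3 * \<mu> / 2 * (u \<bullet> u + l \<bullet> l))"
        using rho by (intro mult_left_mono) auto
      then show ?thesis by (simp only: distrib_left[of \<rho>] mult.assoc[symmetric] rho(2)[simplified mult.assoc[symmetric]])
    qed
    have "y \<bullet> (X *v ((1 / \<epsilon>) *\<^sub>R (A *v y) + G *v du))
      + \<mu> * (u \<bullet> du) + \<beta> * (l \<bullet> (T *v du) + dl \<bullet> (T *v u)) + \<mu> * (l \<bullet> dl)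
      + \<rho> * (y \<bullet> (X *v y) + \<mu> * (u \<bullet> u) + 2 * \<beta> * (l \<bullet> (T *v u)) + \<mu> * (l \<bullet> l))
      + \<phi>1 * Lf * (u \<bullet> a) + \<phi>2 * Lh * ((C1 *v y + E *v u) \<bullet> b) + (C2 *v y + T *v u + \<mu> *\<^sub>R l) \<bullet> c
      - \<phi>1 * (a \<bullet> a) - \<phi>2 * (b \<bullet> b) - c \<bullet> c
      = y \<bullet> (X *v ((1 / \<epsilon>) *\<^sub>R (A *v y))) + y \<bullet> (X *v (G *v du)) + S
      + \<phi>2 * Lh * ((C1 *v y) \<bullet> b) + (C2 *v y) \<bullet> c
      + \<rho> * (y \<bullet> (X *v y) + \<mu> * (u \<bullet> u) + 2 * \<beta> * (l \<bullet> (T *v u)) + \<mu> * (l \<bullet> l))"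
      by (simp only: S_def matrix_vector_right_distrib inner_add_left inner_add_right distrib_left)
    also have "\<dots> \<le> - (K + 1) * (y \<bullet> y)
        + (K1 * (y \<bullet> y) + \<delta> / 8 * (u \<bullet> u)) + (K2 * (y \<bullet> y) + \<delta> / 8 * (a \<bullet> a))
        + (K3 * (y \<bullet> y) + \<delta> / 8 * (b \<bullet> b)) + (K4 * (y \<bullet> y) + \<delta> / 8 * (c \<bullet> c))
        + (K5 * (y \<bullet> y) + \<delta> / 8 * (b \<bullet> b)) + (K6 * (y \<bullet> y) + \<delta> / 8 * (c \<bullet> c))
        - \<delta> * (u \<bullet> u + l \<bullet> l + a \<bullet> a + b \<bullet> b + c \<bullet> c)
        + (\<rho> * (K0 + 1) * (y \<bullet> y) + \<delta> / 4 * (u \<bullet> u + l \<bullet> l))"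
      unfolding fast couple outputs
      using K1(2)[of y u] K2(2)[of y a] K3(2)[of y b] K4(2)[of y c] K5(2)[of y b] K6(2)[of y c] S storage
      by linarith
    also have "\<dots> = - (y \<bullet> y) - 5 * \<delta> / 8 * (u \<bullet> u) - 3 * \<delta> / 4 * (l \<bullet> l)
        - 7 * \<delta> / 8 * (a \<bullet> a) - 3 * \<delta> / 4 * (b \<bullet> b) - 3 * \<delta> / 4 * (c \<bullet> c)"
      by (simp add: K_def algebra_simps)
    also have "\<dots> \<le> 0"
    proof -
      have "0 \<le> 5 * \<delta> / 8 * (u \<bullet> u)" "0 \<le> 3 * \<delta> / 4 * (l \<bullet> l)" "0 \<le> 7 * \<delta> / 8 * (a \<bullet> a)"
        "0 \<le> 3 * \<delta> / 4 * (b \<bullet> b)" "0 \<le> 3 * \<delta> / 4 * (c \<bullet> c)" "0 \<le> y \<bullet> y"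
        using pos by simp_all
      then show ?thesis by linarith
    qed
    finally show "y \<bullet> (X *v ((1 / \<epsilon>) *\<^sub>R (A *v y) + G *v du))
      + \<mu> * (u \<bullet> du) + \<beta> * (l \<bullet> (T *v du) + dl \<bullet> (T *v u)) + \<mu> * (l \<bullet> dl)
      + \<rho> * (y \<bullet> (X *v y) + \<mu> * (u \<bullet> u) + 2 * \<beta> * (l \<bullet> (T *v u)) + \<mu> * (l \<bullet> l))
      + \<phi>1 * Lf * (u \<bullet> a) + \<phi>2 * Lh * ((C1 *v y + E *v u) \<bullet> b) + (C2 *v y + T *v u + \<mu> *\<^sub>R l) \<bullet> c
      - \<phi>1 * (a \<bullet> a) - \<phi>2 * (b \<bullet> b) - c \<bullet> c \<le> 0" .
  qed
qed

section \<open>The linear matrix inequality\<close>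

text \<open>Along a unit direction e, strong convexity forces the gradient component along e to grow
  by at least m per unit length, and the Lipschitz bound allows at most L.\<close>

lemma strong_convexity_le_lipschitz:
  fixes f :: "real^'p \<Rightarrow> real"
  assumes conv: "strongly_convex m f" and lip: "lipschitz_gradient L f gf"
  shows "m \<le> L"
proof -
  obtain e :: "real^'p" where e: "norm e = 1" using vector_choose_size[of 1] by auto
  define q where "q t = f (t *\<^sub>R e) - m / 2 * (norm (t *\<^sub>R e))\<^sup>2" for t
  define q' where "q' t = gf (t *\<^sub>R e) \<bullet> e - m * t" for t
  have "convex_on UNIV q"
    unfolding q_def
  proof (rule convex_onI)
    fix s x y :: real assume s: "0 < s" "s < 1"
    have "f ((1 - s) *\<^sub>R (x *\<^sub>R e) + s *\<^sub>R (y *\<^sub>R e)) - m / 2 * (norm ((1 - s) *\<^sub>R (x *\<^sub>R e) + s *\<^sub>R (y *\<^sub>R e)))\<^sup>2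
      \<le> (1 - s) * (f (x *\<^sub>R e) - m / 2 * (norm (x *\<^sub>R e))\<^sup>2) + s * (f (y *\<^sub>R e) - m / 2 * (norm (y *\<^sub>R e))\<^sup>2)"
      using conv s unfolding strongly_convex_def by (intro convex_onD) auto
    moreover have "(1 - s) *\<^sub>R (x *\<^sub>R e) + s *\<^sub>R (y *\<^sub>R e) = ((1 - s) *\<^sub>R x + s *\<^sub>R y) *\<^sub>R e"
      by (simp add: scaleR_left_distrib)
    ultimately show "f (((1 - s) *\<^sub>R x + s *\<^sub>R y) *\<^sub>R e) - m / 2 * (norm (((1 - s) *\<^sub>R x + s *\<^sub>R y) *\<^sub>R e))\<^sup>2
      \<le> (1 - s) * (f (x *\<^sub>R e) - m / 2 * (norm (x *\<^sub>R e))\<^sup>2) + s * (f (y *\<^sub>R e) - m / 2 * (norm (y *\<^sub>R e))\<^sup>2)"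
      by (simp only:)
  qed simp
  have deriv: "(q has_real_derivative q' t) (at t)" for t
  proof -
    have "(f has_derivative (\<lambda>d. gf (t *\<^sub>R e) \<bullet> d)) (at (t *\<^sub>R e))"
      using lip by (simp add: lipschitz_gradient_def)
    moreover have "((\<lambda>t. t *\<^sub>R e) has_derivative (\<lambda>d. d *\<^sub>R e)) (at t)"
      by (auto intro!: derivative_eq_intros)
    ultimately have "((\<lambda>t. f (t *\<^sub>R e)) has_derivative (\<lambda>d. gf (t *\<^sub>R e) \<bullet> (d *\<^sub>R e))) (at t)"
      by (rule has_derivative_compose[rotated])
    then have "((\<lambda>t. f (t *\<^sub>R e)) has_real_derivative gf (t *\<^sub>R e) \<bullet> e) (at t)"
      by (simp add: has_field_derivative_def mult.commute[of _ "gf (t *\<^sub>R e) \<bullet> e"])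
    moreover have "((\<lambda>t. m / 2 * (norm (t *\<^sub>R e))\<^sup>2) has_real_derivative m * t) (at t)"
      by (auto simp: e power_mult_distrib intro!: derivative_eq_intros)
    ultimately show ?thesis unfolding q_def q'_def by (rule DERIV_diff)
  qed
  \<comment> \<open>Adding the tangent inequalities at 0 and at 1 gives monotonicity of q'.\<close>
  have "q' 0 * (1 - 0) \<le> q 1 - q 0" "q' 1 * (0 - 1) \<le> q 0 - q 1"
    by (rule convex_on_imp_above_tangent[OF \<open>convex_on UNIV q\<close>]; use deriv in simp)+
  then have "m \<le> (gf e - gf 0) \<bullet> e" by (simp add: q'_def inner_diff_left)
  also have "\<dots> \<le> norm (gf e - gf 0) * norm e" by (rule norm_cauchy_schwarz)
  also have "\<dots> \<le> L * norm (e - 0)"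
    using lip unfolding lipschitz_gradient_def by (metis e mult.right_neutral)
  finally show ?thesis by (simp add: e)
qed

lemma lipschitz_gradient_nonneg:
  fixes f :: "real^'p \<Rightarrow> real"
  assumes "lipschitz_gradient L f gf"
  shows "0 \<le> L"
proof -
  obtain e :: "real^'p" where e: "norm e = 1" using vector_choose_size[of 1] by auto
  have "norm (gf e - gf 0) \<le> L * norm (e - 0)"
    using assms unfolding lipschitz_gradient_def by blast
  then show ?thesis using norm_ge_zero[of "gf e - gf 0"] by (simp add: e del: norm_ge_zero)
qed

text \<open>A real kernel vector would be a complex eigenvector for the eigenvalue 0, whose real
  part is not negative.\<close>

lemma hurwitz_right_inverse:
  fixes A :: "real^'n^'n"
  assumes "hurwitz A"
  shows "A ** matrix_inv A = mat 1"
proof -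
  have "x = 0" if "A *v x = 0" for x
  proof (rule ccontr)
    assume "x \<noteq> 0"
    define v :: "complex^'n" where "v = (\<chi> i. complex_of_real (x $ i))"
    have "(cmat A *v v) $ i = complex_of_real ((A *v x) $ i)" for i
      by (simp add: cmat_def v_def matrix_vector_mult_def)
    then have "cmat A *v v = 0 *s v" using that by (simp add: vec_eq_iff)
    moreover have "v \<noteq> 0" using \<open>x \<noteq> 0\<close> by (simp add: v_def vec_eq_iff)
    ultimately show False using hurwitzD[OF assms] by fastforce
  qed
  then have "invertible A"
    using invertible_left_inverse matrix_left_invertible_ker by blast
  then show ?thesis
    unfolding invertible_def matrix_inv_def by (metis (mono_tags, lifting) someI_ex)
qed

text \<open>The matrix of the storage function
  \<open>y \<bullet> X y + \<mu> |u|\<^sup>2 + 2 \<beta> (l \<bullet> T u) + \<mu> |l|\<^sup>2\<close> with \<open>y = x + G u\<close>.\<close>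

definition storage_matrix ::
  "real^'n^'n \<Rightarrow> real^'p^'n \<Rightarrow> real^'p^'r \<Rightarrow> real \<Rightarrow> real \<Rightarrow> real^(('n + 'p) + 'r)^(('n + 'p) + 'r)" where
  "storage_matrix X G T \<mu> \<beta> =
    blk2 (blk2 X (X ** G) (transpose G ** X) (transpose G ** X ** G + \<mu> *\<^sub>R mat 1))
      (vcat 0 (\<beta> *\<^sub>R transpose T)) (hcat 0 (\<beta> *\<^sub>R T)) (\<mu> *\<^sub>R mat 1)"

lemma transpose_storage_matrix:
  assumes "transpose X = X"
  shows "transpose (storage_matrix X G T \<mu> \<beta>) = storage_matrix X G T \<mu> \<beta>"
  by (simp add: storage_matrix_def transpose_blk2 transpose_hcat transpose_vcat transpose_add
      transpose_scalar matrix_transpose_mul assms matrix_mul_assoc)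

text \<open>The polarized form is needed because the LMI pairs the state z with its
  velocity.\<close>

lemma storage_matrix_form:
  fixes X :: "real^'n^'n" and G :: "real^'p^'n" and T :: "real^'p^'r"
  shows "vjoin (vjoin x u) l \<bullet> (storage_matrix X G T \<mu> \<beta> *v vjoin (vjoin x' u') l')
    = (x + G *v u) \<bullet> (X *v (x' + G *v u')) + \<mu> * (u \<bullet> u')
      + \<beta> * (l \<bullet> (T *v u') + l' \<bullet> (T *v u)) + \<mu> * (l \<bullet> l')"
  by (simp add: storage_matrix_def inner_add_left inner_add_right matrix_vector_right_distrib
      matrix_vector_mult_add_rdistrib inner_transpose_mult del: transpose_matrix_vector
      flip: matrix_vector_mul_assoc scaleR_matrix_vector_assoc)
    (simp add: inner_commute algebra_simps)

theorem theorem2: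
  fixes A :: "real^'n^'n" and B :: "real^'p^'n" and Bw :: "real^'q^'n"
    and C1 :: "real^'n^'r1" and D1w :: "real^'q^'r1"
    and C2 :: "real^'n^'r2" and D2w :: "real^'q^'r2"
    and f :: "real \<Rightarrow> real^'p \<Rightarrow> real" and gf :: "real \<Rightarrow> real^'p \<Rightarrow> real^'p"
    and h :: "real \<Rightarrow> real^'r1 \<Rightarrow> real" and gh :: "real \<Rightarrow> real^'r1 \<Rightarrow> real^'r1"
    and g :: "real \<Rightarrow> real^'r2 \<Rightarrow> ereal"
    and w :: "real \<Rightarrow> real^'q"
    and m Lf Lh mu :: real
  assumes hurwitz: "hurwitz A"
    and mu_pos: "0 < mu"
    \<comment> \<open>Assumption 1\<close>
    and A1_f: "\<forall>t\<ge>0. strongly_convex m (f t) \<and> lipschitz_gradient Lf (f t) (gf t)"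
    and A1_h: "\<forall>t\<ge>0. convex_on UNIV (h t) \<and> lipschitz_gradient Lh (h t) (gh t)"
    and A1_g: "\<forall>t\<ge>0. proper_ext (g t) \<and> convex_ext (g t) \<and> lsc_ext (g t)"
    \<comment> \<open>Assumption 2\<close>
    and A2_feas: "\<forall>t\<ge>0. \<exists>u. g t (Pi_u A B C2 *v u + Pi_w A Bw C2 D2w *v w t) < \<infinity>"
    and A2_meas: "\<exists>us ls. (\<forall>t\<ge>0. saddle_point
                     (lagr A B Bw C1 D1w C2 D2w mu (f t) (h t) (g t) (w t)) (us t) (ls t))
                   \<and> (\<lambda>t. (us t, ls t)) \<in> borel_measurable (restrict_space lborel {0..})"
    \<comment> \<open>Assumption 3\<close>
    and A3_meas: "\<forall>z. (\<lambda>t. closed_loop_rhs A B Bw C1 D1w C2 D2w mu gf gh g w t z)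
                     \<in> borel_measurable (restrict_space lborel {0..})"
    and A3_cont: "AE t in lborel. t \<ge> 0 \<longrightarrow>
                    continuous_on UNIV (closed_loop_rhs A B Bw C1 D1w C2 D2w mu gf gh g w t)"
    \<comment> \<open>Theorem hypotheses\<close>
    and Pi2u: "pos_def (Pi_u A B C2 ** transpose (Pi_u A B C2))"
    and mu_ge: "mu \<ge> max (Lf - m) Lh"
  shows "\<exists>eps rho phi1 phi2 (P :: real^(('n + 'p) + 'r2)^(('n + 'p) + 'r2)).
           eps > 0 \<and> rho > 0 \<and> phi1 \<ge> 0 \<and> phi2 \<ge> 0 \<and> pos_def P \<and>
           LMI (A_eps_rho A B m mu eps rho :: real^(('n + 'p) + 'r2)^(('n + 'p) + 'r2)) P
               (B_bold A B C1 C2 mu) (C_bold C1 C2 mu)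
               (Xi (Lf - m) Lh phi1 phi2 :: real^((('p + 'r1) + 'r2) + (('p + 'r1) + 'r2))^_)"
proof -
  define E where "E = Pi_u A B C1"
  define T where "T = Pi_u A B C2"
  \<comment> \<open>Without disturbance the plant at constant u rests at x = - G u, so y = x + G u
    is the deviation from steady state.\<close>
  define G where "G = matrix_inv A ** B"
  have m: "0 < m" and Lf: "0 \<le> Lf - m" and Lh: "0 \<le> Lh"
    using A1_f A1_h strong_convexity_le_lipschitz[of m "f 0" Lf "gf 0"]
      lipschitz_gradient_nonneg[of Lh "h 0" "gh 0"]
    by (auto simp: strongly_convex_def)
  obtain X where X: "pos_def X" "transpose A ** X + X ** A = - mat 1"
    using lyapunov_exists[OF hurwitz] by blast
  have Xsym: "transpose X = X" using X(1) by (simp add: pos_def_def)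
  \<comment> \<open>These three identities rewrite A x + B u as A y and C_i x as C_i y plus the
    steady-state output.\<close>
  have AG: "A *v (G *v u) = B *v u" for u
    by (simp add: G_def matrix_vector_mul_assoc matrix_mul_assoc hurwitz_right_inverse[OF hurwitz])
  have EG: "C1 *v (G *v u) = - (E *v u)" and TG: "C2 *v (G *v u) = - (T *v u)" for u
    by (simp_all add: E_def T_def Pi_u_def G_def neg_matrix_mult matrix_vector_mul_assoc matrix_mul_assoc)
  have TT: "pos_def (T ** transpose T)" using Pi2u by (simp add: T_def)
  obtain \<epsilon> \<rho> \<phi>1 \<phi>2 \<beta> where pos: "0 < \<epsilon>" "0 < \<rho>" "0 < \<phi>1" "0 < \<phi>2" "0 < \<beta>"
    and cross: "\<And>u l. \<bar>2 * \<beta> * (l \<bullet> (T *v u))\<bar> \<le> mu / 2 * (u \<bullet> u + l \<bullet> l)"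
    and diss: "\<And>y u l a b c du dl. du = - (m *\<^sub>R u) - a - transpose E *v b - (1 / mu) *\<^sub>R (transpose T *v c) \<Longrightarrow>
      dl = c - mu *\<^sub>R l \<Longrightarrow>
      y \<bullet> (X *v ((1 / \<epsilon>) *\<^sub>R (A *v y) + G *v du))
      + mu * (u \<bullet> du) + \<beta> * (l \<bullet> (T *v du) + dl \<bullet> (T *v u)) + mu * (l \<bullet> dl)
      + \<rho> * (y \<bullet> (X *v y) + mu * (u \<bullet> u) + 2 * \<beta> * (l \<bullet> (T *v u)) + mu * (l \<bullet> l))
      + \<phi>1 * (Lf - m) * (u \<bullet> a) + \<phi>2 * Lh * ((C1 *v y + E *v u) \<bullet> b) + (C2 *v y + T *v u + mu *\<^sub>R l) \<bullet> c
      - \<phi>1 * (a \<bullet> a) - \<phi>2 * (b \<bullet> b) - c \<bullet> c \<le> 0"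
    by (rule full_dissipation[OF m mu_pos Lf Lh TT Xsym X(2)], rule that, assumption+)
  define P where "P = storage_matrix X G T mu \<beta>"
  have Psym: "transpose P = P" unfolding P_def by (rule transpose_storage_matrix[OF Xsym])
  have "pos_def P"
    unfolding pos_def_def
  proof (intro conjI allI impI Psym)
    fix z :: "real^(('n + 'p) + 'r2)" assume "z \<noteq> 0"
    obtain xu l where "z = vjoin xu l" by (rule vjoin_cases)
    moreover obtain x u where "xu = vjoin x u" by (rule vjoin_cases)
    ultimately have z: "z = vjoin (vjoin x u) l" by simp
    define y where "y = x + G *v u"
    have "z \<bullet> (P *v z) = y \<bullet> (X *v y) + mu * (u \<bullet> u) + 2 * \<beta> * (l \<bullet> (T *v u)) + mu * (l \<bullet> l)"
      by (simp add: z P_def storage_matrix_form y_def)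
    \<comment> \<open>The cross term takes at most half of the weights mu, so definiteness
      survives.\<close>
    then have lower: "y \<bullet> (X *v y) + mu / 2 * (u \<bullet> u) + mu / 2 * (l \<bullet> l) \<le> z \<bullet> (P *v z)"
      using cross[of l u] by (simp add: algebra_simps)
    have nonneg: "0 \<le> y \<bullet> (X *v y)" "0 \<le> mu / 2 * (u \<bullet> u)" "0 \<le> mu / 2 * (l \<bullet> l)"
      using X(1) mu_pos by (cases "y = 0"; simp add: pos_def_def less_imp_le)+
    have "y \<noteq> 0 \<or> u \<noteq> 0 \<or> l \<noteq> 0" using \<open>z \<noteq> 0\<close> by (auto simp: z y_def)
    then have "0 < y \<bullet> (X *v y) \<or> 0 < mu / 2 * (u \<bullet> u) \<or> 0 < mu / 2 * (l \<bullet> l)"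
      using X(1) mu_pos by (auto simp: pos_def_def)
    then show "0 < z \<bullet> (P *v z)" using lower nonneg by linarith
  qed
  moreover have "LMI (A_eps_rho A B m mu \<epsilon> \<rho>) P (B_bold A B C1 C2 mu) (C_bold C1 C2 mu)
      (Xi (Lf - m) Lh \<phi>1 \<phi>2)"
  proof (subst LMI_iff_dissipation[OF Psym], goal_cases)
    case 1
    show ?case by (simp add: Xi_def transpose_blk2 transpose_dg3)
  next
    case 2
    show ?case
    proof (intro allI)
      fix z :: "real^(('n + 'p) + 'r2)" and v :: "real^(('p + 'r1) + 'r2)"
      obtain xu l where "z = vjoin xu l" by (rule vjoin_cases)
      moreover obtain x u where "xu = vjoin x u" by (rule vjoin_cases)
      ultimately have z: "z = vjoin (vjoin x u) l" by simp
      obtain ab c where "v = vjoin ab c" by (rule vjoin_cases)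
      moreover obtain a b where "ab = vjoin a b" by (rule vjoin_cases)
      ultimately have v: "v = vjoin (vjoin a b) c" by simp
      define y where "y = x + G *v u"
      define du where "du = - (m *\<^sub>R u) - a - transpose E *v b - (1 / mu) *\<^sub>R (transpose T *v c)"
      define dl where "dl = c - mu *\<^sub>R l"
      have out: "C_bold C1 C2 mu *v z = vjoin (vjoin u (C1 *v y + E *v u)) (C2 *v y + T *v u + mu *\<^sub>R l)"
        by (simp add: C_bold_def z y_def matrix_vector_right_distrib EG TG flip: scaleR_matrix_vector_assoc)
      have dyn: "A_eps_rho A B m mu \<epsilon> \<rho> *v z + B_bold A B C1 C2 mu *v v
          = vjoin (vjoin ((1 / \<epsilon>) *\<^sub>R (A *v y) + \<rho> *\<^sub>R x) (du + \<rho> *\<^sub>R u)) (dl + \<rho> *\<^sub>R l)"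
        by (simp add: A_eps_rho_def A_eps_def B_bold_def z v y_def du_def dl_def AG E_def T_def
            matrix_vector_right_distrib matrix_vector_mult_add_rdistrib neg_matrix_mult scaleR_right_distrib
            del: transpose_matrix_vector flip: scaleR_matrix_vector_assoc)
          (intro arg_cong2[where f = vjoin]; simp)
      \<comment> \<open>The shift by \<rho> acts on y as it does on z; hence it adds \<rho> times
        the whole storage to the rate.\<close>
      have fast: "((1 / \<epsilon>) *\<^sub>R (A *v y) + \<rho> *\<^sub>R x) + G *v (du + \<rho> *\<^sub>R u)
          = ((1 / \<epsilon>) *\<^sub>R (A *v y) + G *v du) + \<rho> *\<^sub>R y"
        by (simp add: y_def matrix_vector_right_distrib matrix_vector_mult_scaleR scaleR_right_distrib)
      have rate: "z \<bullet> (P *v (A_eps_rho A B m mu \<epsilon> \<rho> *v z + B_bold A B C1 C2 mu *v v))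
        = y \<bullet> (X *v ((1 / \<epsilon>) *\<^sub>R (A *v y) + G *v du))
          + mu * (u \<bullet> du) + \<beta> * (l \<bullet> (T *v du) + dl \<bullet> (T *v u)) + mu * (l \<bullet> dl)
          + \<rho> * (y \<bullet> (X *v y) + mu * (u \<bullet> u) + 2 * \<beta> * (l \<bullet> (T *v u)) + mu * (l \<bullet> l))"
        unfolding dyn unfolding z P_def storage_matrix_form fast y_def[symmetric]
        by (simp add: matrix_vector_right_distrib matrix_vector_mult_scaleR inner_add_left inner_add_right)
          (simp add: algebra_simps)
      have multiplier: "vjoin (C_bold C1 C2 mu *v z) v \<bullet> (Xi (Lf - m) Lh \<phi>1 \<phi>2 *v vjoin (C_bold C1 C2 mu *v z) v)
        = 2 * (\<phi>1 * (Lf - m) * (u \<bullet> a) + \<phi>2 * Lh * ((C1 *v y + E *v u) \<bullet> b)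
            + (C2 *v y + T *v u + mu *\<^sub>R l) \<bullet> c
            - \<phi>1 * (a \<bullet> a) - \<phi>2 * (b \<bullet> b) - c \<bullet> c)"
        unfolding out v Xi_def
        by (simp add: inner_commute inner_add_right inner_add_left) (simp add: algebra_simps)
      have double: "2 * p + 2 * (q1 + q2 + q3 - q4 - q5 - q6) \<le> 0"
        if "p + q1 + q2 + q3 - q4 - q5 - q6 \<le> 0" for p q1 q2 q3 q4 q5 q6 :: real
        using that by simp
      show "2 * (z \<bullet> (P *v (A_eps_rho A B m mu \<epsilon> \<rho> *v z + B_bold A B C1 C2 mu *v v)))
          + vjoin (C_bold C1 C2 mu *v z) v \<bullet> (Xi (Lf - m) Lh \<phi>1 \<phi>2 *v vjoin (C_bold C1 C2 mu *v z) v) \<le> 0"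
        unfolding rate multiplier by (rule double[OF diss[OF du_def dl_def]])
    qed
  qed
  ultimately show ?thesis using pos less_imp_le by blast
qed

end
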